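(* Let $r\geq 1$ be an integer. The $\Lambda$-ring $\mathbf{Z}[\mu_r]=\mathbf{Z}[z]/(z^r-1)$, with $\psi_p(z)=z^p$ for every prime $p$, is the maximal integral $\Lambda$-model of $\mathbf{Q}\otimes\mathbf{Z}[\mu_r]=\mathbf{Q}[z]/(z^r-1)$; that is, it is an integral $\Lambda$-model and it contains every other integral $\Lambda$-model of $\mathbf{Q}\otimes\mathbf{Z}[\mu_r]$.
   Context: Rings are commutative with $1$. A $\Lambda$-ring structure on a ring $R$ whose additive group is torsion free is a family of commuting ring endomorphisms $\psi_p\colon R\to R$, one for each prime $p$, such that $\psi_p(x)-x^p\in pR$ for all $x\in R$. (If $R$ is a $\mathbf{Q}$-algebra the congruence condition is vacuous.) The ring $\mathbf{Q}\otimes\mathbf{Z}[\mu_r]$ carries the $\mathbf{Q}$-linear extensions of the $\psi_p$. A sub-$\Lambda$-ring of a torsion-free $\Lambda$-ring $K$ is a subring $A$ with $\psi_p(A)\subseteq A$ for all $p$ such that the restrictions of the $\psi_p$ make $A$ a $\Lambda$-ring (so $\psi_p(x)-x^p\in pA$ for all $x\in A$). An integral $\Lambda$-model of $K$ is a sub-$\Lambda$-ring $A\subseteq K$ that is finite over $\mathbf{Z}$ (finitely generated as an abelian group) with $\mathbf{Q}\otimes A=K$. *)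

theory Defs
  imports
    "HOL-Algebra.QuotRing"
    "HOL-Algebra.Subrings"
    "HOL-Algebra.Module"
    "HOL-Algebra.Generated_Groups"
    "HOL-Algebra.Free_Abelian_Groups"
    "HOL-Algebra.Algebraic_Closure_Type"
    "HOL-Computational_Algebra.Polynomial"
    "HOL-Computational_Algebra.Primes"
begin

section \<open>Lambda-rings with torsion-free additive group\<close>

text \<open>Only the values \<open>\<psi> p x\<close> with \<open>p\<close> prime and \<open>x\<close> in the carrier are meaningful.\<close>

locale lambda_ring = cring R for R (structure) +
  fixes \<psi> :: "nat \<Rightarrow> 'a \<Rightarrow> 'a"
  assumes torsion_free:
      "\<lbrakk>x \<in> carrier R; n > (0::nat); [n] \<cdot> x = \<zero>\<rbrakk> \<Longrightarrow> x = \<zero>"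
    and psi_hom: "Factorial_Ring.prime p \<Longrightarrow> \<psi> p \<in> ring_hom R R"
    and psi_commute:
      "\<lbrakk>Factorial_Ring.prime p; Factorial_Ring.prime q; x \<in> carrier R\<rbrakk>
        \<Longrightarrow> \<psi> p (\<psi> q x) = \<psi> q (\<psi> p x)"
    and psi_frobenius:
      "\<lbrakk>Factorial_Ring.prime p; x \<in> carrier R\<rbrakk>
        \<Longrightarrow> \<exists>y \<in> carrier R. \<psi> p x \<ominus> x [^] p = [p] \<cdot> y"

text \<open>The stability \<open>\<psi> p ` A \<subseteq> A\<close> is part of \<open>\<psi> p\<close> being an endomorphism of \<open>A\<close>, but it is
  listed separately; the congruence in the last clause is modulo \<open>p A\<close>, not modulo \<open>p K\<close>.\<close>

definition sub_lambda_ring :: "'a set \<Rightarrow> ('a, 'm) ring_scheme \<Rightarrow> (nat \<Rightarrow> 'a \<Rightarrow> 'a) \<Rightarrow> bool" where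
  "sub_lambda_ring A K \<psi> \<longleftrightarrow>
     lambda_ring K \<psi> \<and> subring A K \<and>
     (\<forall>p. Factorial_Ring.prime p \<longrightarrow> \<psi> p ` A \<subseteq> A) \<and>
     lambda_ring (K\<lparr>carrier := A\<rparr>) \<psi>"

definition lambda_embedding ::
  "('a, 'm) ring_scheme \<Rightarrow> (nat \<Rightarrow> 'a \<Rightarrow> 'a) \<Rightarrow> ('b, 'n) ring_scheme \<Rightarrow> (nat \<Rightarrow> 'b \<Rightarrow> 'b)
    \<Rightarrow> ('a \<Rightarrow> 'b) \<Rightarrow> bool" where
  "lambda_embedding R \<psi> S \<phi> f \<longleftrightarrow>
     f \<in> ring_hom R S \<and> inj_on f (carrier R) \<and>
     (\<forall>p. Factorial_Ring.prime p \<longrightarrow> (\<forall>x \<in> carrier R. f (\<psi> p x) = \<phi> p (f x)))"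


section \<open>Tensor products over the integers and integral models\<close>

definition tensor_relations ::
  "('a, 'm) monoid_scheme \<Rightarrow> ('b, 'n) monoid_scheme \<Rightarrow> ('a \<times> 'b \<Rightarrow>\<^sub>0 int) set" where
  "tensor_relations G H =
     {frag_of (x \<otimes>\<^bsub>G\<^esub> x', y) - frag_of (x, y) - frag_of (x', y) | x x' y.
        x \<in> carrier G \<and> x' \<in> carrier G \<and> y \<in> carrier H} \<union>
     {frag_of (x, y \<otimes>\<^bsub>H\<^esub> y') - frag_of (x, y) - frag_of (x, y') | x y y'.
        x \<in> carrier G \<and> y \<in> carrier H \<and> y' \<in> carrier H}"

text \<open>The tensor product over the integers of two abelian groups, which are written
  multiplicatively here as everywhere in \<^theory>\<open>HOL-Algebra.Group\<close>.\<close>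

definition tensor_Z ::
  "('a, 'm) monoid_scheme \<Rightarrow> ('b, 'n) monoid_scheme \<Rightarrow> ('a \<times> 'b \<Rightarrow>\<^sub>0 int) set monoid" where
  "tensor_Z G H =
     (let F = free_Abelian_group (carrier G \<times> carrier H)
      in F Mod generate F (tensor_relations G H))"

abbreviation rat_ring :: "rat ring" where
  "rat_ring \<equiv> ring_of_type_algebra"

definition scaling_sum :: "(rat, 'a, 'm) module_scheme \<Rightarrow> (rat \<times> 'a \<Rightarrow>\<^sub>0 int) \<Rightarrow> 'a" where
  "scaling_sum K c =
     finsum K (\<lambda>(q, a). [Poly_Mapping.lookup c (q, a)] \<cdot>\<^bsub>K\<^esub> (q \<odot>\<^bsub>K\<^esub> a)) (Poly_Mapping.keys c)"

text \<open>The map \<open>\<rat> \<otimes> A \<rightarrow> K\<close>, \<open>q \<otimes> a \<mapsto> q a\<close>, on cosets of the subgroup of relations: every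
  element of such a coset has the same \<^const>\<open>scaling_sum\<close>.\<close>

definition scaling_map :: "(rat, 'a, 'm) module_scheme \<Rightarrow> (rat \<times> 'a \<Rightarrow>\<^sub>0 int) set \<Rightarrow> 'a" where
  "scaling_map K C = the_elem (scaling_sum K ` C)"

text \<open>The equality \<open>\<rat> \<otimes> A = K\<close> for a subring \<open>A\<close> of \<open>K\<close>, meaning that the canonical map is
  an isomorphism.\<close>

definition rational_tensor_eq :: "'a set \<Rightarrow> (rat, 'a, 'm) module_scheme \<Rightarrow> bool" where
  "rational_tensor_eq A K \<longleftrightarrow>
     scaling_map K \<in>
       iso (tensor_Z (add_monoid rat_ring) (add_monoid (K\<lparr>carrier := A\<rparr>))) (add_monoid K)"

definition integral_lambda_model ::
  "'a set \<Rightarrow> (rat, 'a, 'm) module_scheme \<Rightarrow> (nat \<Rightarrow> 'a \<Rightarrow> 'a) \<Rightarrow> bool" where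
  "integral_lambda_model A K \<psi> \<longleftrightarrow>
     algebra rat_ring K \<and> sub_lambda_ring A K \<psi> \<and>
     (\<exists>S. finite S \<and> S \<subseteq> A \<and> generate (add_monoid K) S = A) \<and>
     rational_tensor_eq A K"


section \<open>The rings \<open>R[z]/(z\<^sup>r - 1)\<close>\<close>

abbreviation poly_ring_of :: "'a::comm_ring_1 poly ring" where
  "poly_ring_of \<equiv> ring_of_type_algebra"

definition mu_ideal :: "nat \<Rightarrow> 'a::comm_ring_1 poly set" where
  "mu_ideal r = PIdl\<^bsub>poly_ring_of\<^esub> (Polynomial.monom 1 r - 1)"

definition mu_ring :: "nat \<Rightarrow> 'a::comm_ring_1 poly set ring" where
  "mu_ring r = poly_ring_of Quot mu_ideal r"

definition mu_class :: "nat \<Rightarrow> 'a::comm_ring_1 poly \<Rightarrow> 'a poly set" where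
  "mu_class r f = mu_ideal r +>\<^bsub>poly_ring_of\<^esub> f"

text \<open>The endomorphism induced by \<open>f(z) \<mapsto> f(z\<^sup>p)\<close>; see \<open>mu_psi_class\<close> below.
  Over the rationals this is the \<open>\<rat>\<close>-linear extension of the endomorphism over the integers.\<close>

definition mu_psi :: "nat \<Rightarrow> nat \<Rightarrow> 'a::comm_ring_1 poly set \<Rightarrow> 'a poly set" where
  "mu_psi r p C = the_elem ((\<lambda>f. mu_class r (pcompose f (Polynomial.monom 1 p))) ` C)"

definition mu_rat_algebra :: "nat \<Rightarrow> (rat, rat poly set) module" where
  "mu_rat_algebra r =
     \<lparr>carrier = carrier (mu_ring r), monoid.mult = monoid.mult (mu_ring r), one = monoid.one (mu_ring r),
      zero = ring.zero (mu_ring r), add = ring.add (mu_ring r),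
      module.smult = (\<lambda>q C. mu_class r [:q:] \<otimes>\<^bsub>mu_ring r\<^esub> C)\<rparr>"

text \<open>The canonical map \<open>\<int>[z]/(z\<^sup>r - 1) \<rightarrow> \<rat>[z]/(z\<^sup>r - 1)\<close>; see \<open>mu_incl_class\<close> below.\<close>

definition mu_incl :: "nat \<Rightarrow> int poly set \<Rightarrow> rat poly set" where
  "mu_incl r C = the_elem ((\<lambda>f. mu_class r (map_poly rat_of_int f)) ` C)"


section \<open>The induced maps are well defined\<close>

lemma mu_ideal_eq: "mu_ideal r = {f. (Polynomial.monom 1 r - 1) dvd f}"
proof -
  have "mu_ideal r = {x * (Polynomial.monom 1 r - 1) | x. True}"
    by (simp add: mu_ideal_def cgenideal_def ring_of_type_algebra_def)
  then show ?thesis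
    by (simp add: dvd_def Groups.mult.commute[of _ "Polynomial.monom 1 r - 1"])
qed

lemma mu_class_eq: "mu_class r f = {g. (Polynomial.monom 1 r - 1) dvd g - f}"
proof -
  have "mu_class r f = (\<lambda>h. h + f) ` mu_ideal r"
    by (auto simp: mu_class_def a_r_coset_def r_coset_def ring_of_type_algebra_def)
  also have "\<dots> = {g. (Polynomial.monom 1 r - 1) dvd g - f}"
  proof (intro Set.set_eqI iffI)
    fix g assume "g \<in> {g. (Polynomial.monom 1 r - 1) dvd g - f}"
    then have "g - f \<in> mu_ideal r" by (simp add: mu_ideal_eq)
    then show "g \<in> (\<lambda>h. h + f) ` mu_ideal r" by (rule rev_image_eqI) simp
  next
    fix g assume "g \<in> (\<lambda>h. h + f) ` mu_ideal r"
    then show "g \<in> {g. (Polynomial.monom 1 r - 1) dvd g - f}" by (auto simp: mu_ideal_eq)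
  qed
  finally show ?thesis .
qed

lemma mu_class_cong:
  assumes "(Polynomial.monom 1 r - 1) dvd f - g"
  shows "mu_class r f = mu_class r g"
proof -
  have "(Polynomial.monom 1 r - 1) dvd h - f \<longleftrightarrow> (Polynomial.monom 1 r - 1) dvd h - g" for h
    using dvd_add_right_iff[OF assms, of "h - f"] by simp
  then show ?thesis by (simp add: mu_class_eq)
qed

lemma self_in_mu_class: "f \<in> mu_class r f"
  by (simp add: mu_class_eq)

lemma carrier_mu_ring: "carrier (mu_ring r) = range (mu_class r)"
  unfolding mu_ring_def FactRing_def A_RCOSETS_def RCOSETS_def mu_class_def[abs_def] a_r_coset_def
  by (simp add: ring_of_type_algebra_def UNION_singleton_eq_range)

lemma the_elem_mu_class:
  assumes "\<And>g. (Polynomial.monom 1 r - 1) dvd g - f \<Longrightarrow> F g = F f"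
  shows "the_elem (F ` mu_class r f) = F f"
proof -
  have "F ` mu_class r f = {F f}"
    using assms self_in_mu_class[of f r] unfolding mu_class_eq by blast
  then show ?thesis by simp
qed

lemma mu_psi_class:
  "mu_psi r p (mu_class r f) = mu_class r (pcompose f (Polynomial.monom 1 p))"
  unfolding mu_psi_def
proof (rule the_elem_mu_class, rule mu_class_cong)
  fix g assume "(Polynomial.monom 1 r - 1) dvd g - f"
  then obtain h where h: "g - f = (Polynomial.monom 1 r - 1) * h" by (auto simp: dvd_def)
  have x: "pcompose (Polynomial.monom 1 r) q = q ^ r" for q :: "'a poly"
    by (induction r) (auto simp: monom_Suc pcompose_pCons monom_0)
  have "pcompose (Polynomial.monom 1 r - 1) (Polynomial.monom 1 p)
      = (Polynomial.monom 1 r ^ p - 1 :: 'a poly)"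
    by (simp add: pcompose_diff pcompose_1 x monom_power mult.commute)
  moreover have "(Polynomial.monom 1 r - 1 :: 'a poly) dvd Polynomial.monom 1 r ^ p - 1"
    by (simp add: power_diff_1_eq)
  ultimately show "(Polynomial.monom 1 r - 1) dvd
      pcompose g (Polynomial.monom 1 p) - pcompose f (Polynomial.monom 1 p)"
    by (simp add: pcompose_diff[symmetric] h pcompose_mult)
qed

lemma mu_incl_class: "mu_incl r (mu_class r f) = mu_class r (map_poly rat_of_int f)"
  unfolding mu_incl_def
proof (rule the_elem_mu_class, rule mu_class_cong)
  fix g :: "int poly" assume "(Polynomial.monom 1 r - 1) dvd g - f"
  then obtain h where h: "g - f = (Polynomial.monom 1 r - 1) * h" by (auto simp: dvd_def)
  have d: "map_poly rat_of_int (a - b) = map_poly rat_of_int a - map_poly rat_of_int b" for a b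
    by (rule poly_eqI) (simp add: coeff_map_poly)
  have m: "map_poly rat_of_int (a * b) = map_poly rat_of_int a * map_poly rat_of_int b" for a b
    by (rule poly_eqI) (simp add: coeff_map_poly coeff_mult)
  have "map_poly rat_of_int (Polynomial.monom 1 r - 1) = Polynomial.monom 1 r - 1"
    by (rule poly_eqI) (simp add: coeff_map_poly)
  then show "(Polynomial.monom 1 r - 1) dvd map_poly rat_of_int g - map_poly rat_of_int f"
    by (simp add: d[symmetric] h m)
qed

end

theory Submission
  imports Defs "HOL-Number_Theory.Residues"
begin

text \<open>
  Everything takes place in \<open>\<rat>[z]\<close>, where a model \<open>A\<close> is replaced by its preimage. After
  adjoining \<open>z\<close> to \<open>A\<close> and passing to the elements that are \<open>p\<close>-power torsion modulo
  \<open>B\<^sub>r = \<int>[z] + (z\<^sup>r - 1)\<close>, it suffices to treat one prime \<open>p\<close>, and one argues by induction on the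
  exponent of \<open>p\<close> in \<open>r\<close>. Write \<open>r = p\<^sup>n m\<close> with \<open>p\<close> not dividing \<open>m\<close>; then
  \<open>\<int>[z]/(p, z\<^sup>m - 1)\<close> is reduced. For \<open>n = 0\<close> this means that \<open>p\<close>-th powers make denominators
  grow, so boundedness excludes them. If \<open>r = d p\<close>, then by induction
  an element of \<open>A\<close> has the form \<open>g + (z\<^sup>d - 1) y\<close> with \<open>g\<close> integral. As \<open>\<psi>\<^sub>p\<close> kills
  \<open>x = (z\<^sup>d - 1) y\<close>, the congruence yields \<open>x\<^sup>p / p \<in> A\<close>. Modulo
  \<open>\<Psi> = (z\<^sup>r - 1)/(z\<^sup>d - 1)\<close> one has \<open>(z\<^sup>d - 1)\<^bsup>p-1\<^esup> = - p q\<close> with \<open>q \<equiv> 1\<close> modulo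
  \<open>z\<^sup>m - 1\<close>, so the set of these \<open>y\<close> is closed under \<open>y \<mapsto> q y\<^sup>p\<close>. Again denominators would
  grow, this time measured by powers of \<open>z\<^sup>m - 1\<close>, a power of which is divisible by \<open>p\<close>
  modulo \<open>\<Psi>\<close>.
\<close>

section \<open>Subrings and integral polynomials\<close>

locale comm_subring =
  fixes S :: "'a::comm_ring_1 set"
  assumes one_mem: "1 \<in> S"
    and diff_mem: "\<lbrakk>x \<in> S; y \<in> S\<rbrakk> \<Longrightarrow> x - y \<in> S"
    and mult_mem: "\<lbrakk>x \<in> S; y \<in> S\<rbrakk> \<Longrightarrow> x * y \<in> S"
begin

lemma zero_mem: "0 \<in> S"
  using diff_mem[OF one_mem one_mem] by simp

lemma uminus_mem: "x \<in> S \<Longrightarrow> - x \<in> S"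
  using diff_mem[OF zero_mem] by force

lemma add_mem: "\<lbrakk>x \<in> S; y \<in> S\<rbrakk> \<Longrightarrow> x + y \<in> S"
  using diff_mem[OF _ uminus_mem, of x y] by simp

lemma power_mem: "x \<in> S \<Longrightarrow> x ^ n \<in> S"
  by (induction n) (auto intro: one_mem mult_mem)

lemma of_nat_mem: "of_nat n \<in> S"
  by (induction n) (auto intro: zero_mem one_mem add_mem)

lemma of_int_mem: "of_int n \<in> S"
  by (cases n) (auto intro!: uminus_mem of_nat_mem simp flip: of_nat_Suc simp del: of_nat_Suc)

lemma sum_mem: "(\<And>i. i \<in> I \<Longrightarrow> f i \<in> S) \<Longrightarrow> sum f I \<in> S"
  by (induction I rule: infinite_finite_induct) (auto intro: zero_mem add_mem)

lemmas mems = zero_mem one_mem diff_mem mult_mem uminus_mem add_mem power_mem of_nat_mem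

lemma power_prime_add:
  assumes "Factorial_Ring.prime p" "x \<in> S" "y \<in> S"
  obtains w where "w \<in> S" "(x + y) ^ p = x ^ p + y ^ p + of_nat p * w"
proof
  \<comment> \<open>Dividing the binomial coefficient by \<open>p\<close> among the natural numbers
    makes \<open>w\<close> an explicit expression in \<open>x\<close> and \<open>y\<close>, so it
    lies in \<open>S\<close> without any division by \<open>p\<close> in the ring.\<close>
  define c where "c k = (of_nat ((p choose k) div p) :: 'a)" for k
  have p: "p > 0" using assms(1) by (simp add: prime_gt_0_nat)
  have split: "{..p} = insert 0 (insert p {1..<p})" using p by auto
  have "(x + y) ^ p = (\<Sum>k\<le>p. of_nat (p choose k) * x ^ k * y ^ (p - k))"
    by (rule binomial_ring)
  also have "\<dots> = x ^ p + y ^ p + (\<Sum>k\<in>{1..<p}. of_nat (p choose k) * x ^ k * y ^ (p - k))"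
    unfolding split using p by (subst sum.insert, simp, force, subst sum.insert) auto
  also have "(\<Sum>k\<in>{1..<p}. of_nat (p choose k) * x ^ k * y ^ (p - k)) =
      (\<Sum>k\<in>{1..<p}. of_nat p * (c k * x ^ k * y ^ (p - k)))"
  proof (rule sum.cong[OF refl])
    fix k assume "k \<in> {1..<p}"
    then have "p dvd (p choose k)" using assms(1) by (intro dvd_choose_prime) auto
    then have "(of_nat (p choose k) :: 'a) = of_nat p * c k"
      by (simp add: c_def flip: of_nat_mult)
    then show "of_nat (p choose k) * x ^ k * y ^ (p - k) = of_nat p * (c k * x ^ k * y ^ (p - k))"
      by (simp add: mult.assoc)
  qed
  finally show "(x + y) ^ p = x ^ p + y ^ p + of_nat p * (\<Sum>k\<in>{1..<p}. c k * x ^ k * y ^ (p - k))"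
    by (simp add: sum_distrib_left)
  show "(\<Sum>k\<in>{1..<p}. c k * x ^ k * y ^ (p - k)) \<in> S"
    unfolding c_def by (intro sum_mem mult_mem power_mem of_nat_mem assms)
qed

end

section \<open>Integral polynomials inside Q[z] and division by monic ones\<close>

definition int_polys :: "rat poly set" where
  "int_polys = {f. \<forall>i. coeff f i \<in> \<int>}"

interpretation Z: comm_subring int_polys
proof
  fix f g assume "f \<in> int_polys" "g \<in> int_polys"
  then show "f - g \<in> int_polys" "f * g \<in> int_polys"
    by (auto simp: int_polys_def coeff_mult intro!: Ints_sum)
qed (simp add: int_polys_def flip: one_poly_def)

lemma monom_int_polys: "Polynomial.monom 1 k \<in> int_polys"
  by (simp add: int_polys_def)

lemma int_polys_pCons_iff: "pCons a f \<in> int_polys \<longleftrightarrow> a \<in> \<int> \<and> f \<in> int_polys"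
  by (auto simp: int_polys_def coeff_pCons split: nat.splits)

lemma int_polys_eq_range: "int_polys = range (map_poly rat_of_int)"
proof (intro equalityI subsetI)
  fix f assume "f \<in> int_polys"
  then show "f \<in> range (map_poly rat_of_int)"
  proof (induction f)
    case 0
    show ?case by (rule image_eqI[of _ _ 0]) auto
  next
    case (pCons a f)
    then obtain k g where "a = of_int k" "f = map_poly rat_of_int g"
      by (auto simp: int_polys_pCons_iff elim: Ints_cases)
    then have "pCons a f = map_poly rat_of_int (pCons k g)"
      by (simp add: map_poly_pCons)
    then show ?case by blast
  qed
qed (auto simp: int_polys_def coeff_map_poly)

lemma pcompose_monom_int_polys: "f \<in> int_polys \<Longrightarrow> pcompose f (Polynomial.monom 1 k) \<in> int_polys"
proof (induction f)
  case (pCons a f)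
  then show ?case
    by (auto simp: pcompose_pCons int_polys_pCons_iff Z.zero_mem intro!: Z.mems monom_int_polys)
qed (simp add: Z.zero_mem)

text \<open>Pseudo-division over the integers scales the dividend by a power of the leading
  coefficient of the divisor. That coefficient is 1 here, so it is true division, which is then
  carried over to \<open>rat poly\<close>.\<close>

lemma int_polys_monic_division:
  assumes "f \<in> int_polys" "D \<in> int_polys" "lead_coeff D = 1"
  obtains q s where "q \<in> int_polys" "s \<in> int_polys" "f = D * q + s" "s = 0 \<or> degree s < degree D"
proof -
  have hom: "map_poly rat_of_int (a + b) = map_poly rat_of_int a + map_poly rat_of_int b"
    "map_poly rat_of_int (a * b) = map_poly rat_of_int a * map_poly rat_of_int b" for a b
    by (auto intro!: poly_eqI simp: coeff_map_poly coeff_mult)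
  obtain f' D' where f': "f = map_poly rat_of_int f'" and D': "D = map_poly rat_of_int D'"
    using assms(1,2) by (auto simp: int_polys_eq_range)
  have deg: "degree (map_poly rat_of_int g) = degree g" for g
    by (rule degree_map_poly) auto
  have lead: "lead_coeff D' = 1"
    using assms(3) by (simp add: D' deg coeff_map_poly)
  obtain q s where qs: "pseudo_divmod f' D' = (q, s)" by force
  have "D' \<noteq> 0" using lead by auto
  from pseudo_divmod[OF this qs] have "f' = D' * q + s" "s = 0 \<or> degree s < degree D'"
    using lead by auto
  then show thesis
    by (intro that[of "map_poly rat_of_int q" "map_poly rat_of_int s"])
      (auto simp: int_polys_eq_range f' D' hom deg)
qed

text \<open>Dividing \<open>D * f\<close> by \<open>D\<close> in Z[z] leaves a remainder that is a
  multiple of \<open>D\<close> of smaller degree, hence zero. Integrality of quotients is obtained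
  in this way below.\<close>

lemma int_polys_cancel_monic:
  assumes "D * f \<in> int_polys" "D \<in> int_polys" "lead_coeff D = 1"
  shows "f \<in> int_polys"
proof -
  obtain q s where qs: "q \<in> int_polys" "D * f = D * q + s" "s = 0 \<or> degree s < degree D"
    using int_polys_monic_division[OF assms] by metis
  have D: "D \<noteq> 0" using assms(3) by auto
  have s: "s = D * (f - q)" using qs(2) by (simp add: algebra_simps)
  have "f - q = 0"
  proof (rule ccontr)
    assume "f - q \<noteq> 0"
    then show False using qs(3) D s by (simp add: degree_mult_eq)
  qed
  then show ?thesis using qs(1) by simp
qed

section \<open>Ideals of Z[z] with two generators\<close>

definition int_ideal :: "rat poly \<Rightarrow> rat poly \<Rightarrow> rat poly set" where
  "int_ideal a b = {a * s + b * t | s t. s \<in> int_polys \<and> t \<in> int_polys}"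

lemma int_idealI: "\<lbrakk>x = a * s + b * t; s \<in> int_polys; t \<in> int_polys\<rbrakk> \<Longrightarrow> x \<in> int_ideal a b"
  by (auto simp: int_ideal_def)

lemma int_idealE:
  assumes "x \<in> int_ideal a b"
  obtains s t where "x = a * s + b * t" "s \<in> int_polys" "t \<in> int_polys"
  using assms by (auto simp: int_ideal_def)

lemma int_ideal_add: "\<lbrakk>x \<in> int_ideal a b; y \<in> int_ideal a b\<rbrakk> \<Longrightarrow> x + y \<in> int_ideal a b"
proof (elim int_idealE)
  fix s t s' t' assume "x = a * s + b * t" "y = a * s' + b * t'"
    "s \<in> int_polys" "t \<in> int_polys" "s' \<in> int_polys" "t' \<in> int_polys"
  then show ?thesis
    by (intro int_idealI[of _ a "s + s'" b "t + t'"] Z.mems) (auto simp: algebra_simps)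
qed

lemma int_ideal_mult: "\<lbrakk>x \<in> int_ideal a b; c \<in> int_polys\<rbrakk> \<Longrightarrow> c * x \<in> int_ideal a b"
proof (elim int_idealE)
  fix s t assume "x = a * s + b * t" "s \<in> int_polys" "t \<in> int_polys" "c \<in> int_polys"
  then show ?thesis
    by (intro int_idealI[of _ a "c * s" b "c * t"] Z.mems) (auto simp: algebra_simps)
qed

lemma int_ideal_diff: "\<lbrakk>x \<in> int_ideal a b; y \<in> int_ideal a b\<rbrakk> \<Longrightarrow> x - y \<in> int_ideal a b"
  using int_ideal_add[of x a b "- 1 * y"] int_ideal_mult[of y a b "- 1"] Z.uminus_mem[OF Z.one_mem]
  by simp

lemma int_ideal_gen1: "c \<in> int_polys \<Longrightarrow> a * c \<in> int_ideal a b"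
  by (rule int_idealI[of _ a c b 0]) (auto simp: Z.zero_mem)

lemma int_ideal_gen2: "c \<in> int_polys \<Longrightarrow> b * c \<in> int_ideal a b"
  by (rule int_idealI[of _ a 0 b c]) (auto simp: Z.zero_mem)

lemma int_ideal_subset:
  assumes "a \<in> int_ideal c d" "b \<in> int_ideal c d"
  shows "int_ideal a b \<subseteq> int_ideal c d"
proof
  fix x assume "x \<in> int_ideal a b"
  then obtain s t where "x = s * a + t * b" "s \<in> int_polys" "t \<in> int_polys"
    by (metis int_idealE mult.commute)
  then show "x \<in> int_ideal c d" using assms by (auto intro: int_ideal_add int_ideal_mult)
qed

lemma int_ideal_power_diff:
  assumes "x - y \<in> int_ideal a b" "x \<in> int_polys" "y \<in> int_polys"
  shows "x ^ n - y ^ n \<in> int_ideal a b"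
proof (cases n)
  case (Suc k)
  have "x ^ n - y ^ n = (\<Sum>i<n. y ^ (n - Suc i) * x ^ i) * (x - y)"
    by (simp add: power_diff_sumr2)
  then show ?thesis
    using assms by (auto intro!: int_ideal_mult Z.sum_mem Z.mems)
qed (use int_ideal_diff[OF assms(1) assms(1)] in simp)

section \<open>The substitution z -> z^k and the Frobenius congruence\<close>

abbreviation substX :: "nat \<Rightarrow> 'a::comm_ring_1 poly \<Rightarrow> 'a poly" where
  "substX k f \<equiv> pcompose f (Polynomial.monom 1 k)"

lemma pcompose_monom_1: "pcompose (Polynomial.monom 1 k) q = q ^ k"
  for q :: "'a::comm_ring_1 poly"
  by (induction k) (auto simp: monom_Suc pcompose_pCons monom_0)

lemma substX_substX: "substX j (substX k f) = substX (j * k) f"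
  by (simp add: pcompose_monom_1 monom_power flip: pcompose_assoc)

lemma substX_1: "substX 1 f = f"
  for f :: "'a::comm_ring_1 poly"
proof -
  have "Polynomial.monom 1 1 = ([:0, 1:] :: 'a poly)" by (simp add: monom_Suc monom_0)
  then show ?thesis by (simp only: pcompose_idR)
qed

text \<open>Modulo \<open>p\<close>, both f(z) -> f(z^p) and f -> f^p are ring homomorphisms; they
  agree on z, and on constants by the third assumption, so induction along the Horner form applies.
  Coefficients range over a subset \<open>S\<close> in order to cover both the type
  \<open>int\<close> and the integers inside \<open>rat\<close>.\<close>

lemma substX_prime:
  assumes "comm_subring (S :: 'a::comm_ring_1 set)" "Factorial_Ring.prime p"
    and "\<And>a. a \<in> S \<Longrightarrow> \<exists>b\<in>S. a - a ^ p = of_nat p * b"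
    and "\<forall>i. coeff f i \<in> S"
  shows "\<exists>g. (\<forall>i. coeff g i \<in> S) \<and> substX p f - f ^ p = of_nat p * g"
proof -
  interpret S: comm_subring S by fact
  interpret P: comm_subring "{f. \<forall>i. coeff f i \<in> S}"
    by unfold_locales (auto simp: coeff_mult S.mems intro!: S.sum_mem simp flip: one_poly_def
      simp: coeff_1 split: if_splits)
  show ?thesis
    using assms(4)
  proof (induction f)
    case (pCons a f)
    then have f: "f \<in> {f. \<forall>i. coeff f i \<in> S}" and a: "a \<in> S"
      by (simp_all, metis coeff_pCons_Suc, metis coeff_pCons_0)
    obtain g where g: "g \<in> {f. \<forall>i. coeff f i \<in> S}" "substX p f - f ^ p = of_nat p * g"
      using pCons f by auto
    obtain b where b: "b \<in> S" "a - a ^ p = of_nat p * b" using assms(3) a by blast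
    have C: "[:c:] \<in> {f. \<forall>i. coeff f i \<in> S}" if "c \<in> S" for c
      using that by (auto simp: coeff_pCons S.zero_mem split: nat.splits)
    have X: "Polynomial.monom 1 k \<in> {f. \<forall>i. coeff f i \<in> S}" for k
      by (auto simp: S.mems)
    have Xf: "Polynomial.monom 1 1 * f \<in> {f. \<forall>i. coeff f i \<in> S}"
      using X f by (rule P.mult_mem)
    obtain w where w: "w \<in> {f. \<forall>i. coeff f i \<in> S}"
      "([:a:] + Polynomial.monom 1 1 * f) ^ p =
        [:a:] ^ p + (Polynomial.monom 1 1 * f) ^ p + of_nat p * w"
      using P.power_prime_add[OF assms(2) C[OF a] Xf] by blast
    have pc: "pCons a f = [:a:] + Polynomial.monom 1 1 * f"
      by (simp add: monom_Suc monom_0)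
    have ca: "[:a:] ^ p = [:a ^ p:]" by (simp add: poly_const_pow)
    have "[:a:] - [:a ^ p:] = [:of_nat p * b:]" using b by simp
    then have cb: "[:a:] - [:a ^ p:] = of_nat p * [:b:]" by (simp add: of_nat_poly)
    have "substX p (pCons a f) - pCons a f ^ p =
       ([:a:] - [:a ^ p:]) + Polynomial.monom 1 p * (substX p f - f ^ p) - of_nat p * w"
      unfolding pc w(2) ca
      by (simp add: pcompose_pCons pcompose_add pcompose_mult pcompose_monom_1 power_mult_distrib
        monom_power algebra_simps)
    also have "\<dots> = of_nat p * ([:b:] + Polynomial.monom 1 p * g - w)"
      unfolding cb g(2) by (simp add: algebra_simps)
    finally show ?case
      using P.diff_mem[OF P.add_mem[OF C[OF b(1)] P.mult_mem[OF X g(1)]] w(1)] by blast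
  qed (use assms(2) in \<open>auto intro!: exI[of _ 0] simp: S.zero_mem prime_gt_0_nat power_0_left\<close>)
qed

text \<open>Modulo \<open>p\<close>, replacing \<open>a\<close> by \<open>a + 1\<close> does not
  change \<open>a - a ^ p\<close>, so induction runs from 0 in both directions.\<close>

lemma fermat_int:
  fixes a :: int
  assumes "Factorial_Ring.prime p"
  shows "\<exists>b. a - a ^ p = of_nat p * b"
proof -
  interpret I: comm_subring "UNIV :: int set" by unfold_locales auto
  have step: "(\<exists>b. a - a ^ p = of_nat p * b) \<longleftrightarrow> (\<exists>b. a + 1 - (a + 1) ^ p = of_nat p * b)" for a :: int
  proof -
    obtain w where "(a + 1) ^ p = a ^ p + 1 ^ p + of_nat p * w"
      using I.power_prime_add[OF assms, of a 1] by auto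
    then have eq: "a + 1 - (a + 1) ^ p = (a - a ^ p) + of_nat p * (- w)" by simp
    have "of_nat p dvd a + 1 - (a + 1) ^ p \<longleftrightarrow> of_nat p dvd a - a ^ p"
      unfolding eq by (rule dvd_add_left_iff) simp
    then show ?thesis unfolding dvd_def by simp
  qed
  show ?thesis
  proof (induction a rule: int_induct[where k = 0])
    case base
    then show ?case using assms by (auto simp: prime_gt_0_nat power_0_left)
  next
    case (step1 i)
    then show ?case using step by blast
  next
    case (step2 i)
    then show ?case using step[of "i - 1"] by simp
  qed
qed

lemma substX_prime_int_poly:
  assumes "Factorial_Ring.prime p"
  shows "\<exists>g :: int poly. substX p f - f ^ p = of_nat p * g"
  using substX_prime[of UNIV p f] fermat_int[OF assms] assms by (auto simp: comm_subring_def)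

lemma substX_prime_int_polys:
  assumes "Factorial_Ring.prime p" "f \<in> int_polys"
  shows "\<exists>g\<in>int_polys. substX p f - f ^ p = of_nat p * g"
proof -
  have "comm_subring (\<int> :: rat set)" by unfold_locales auto
  moreover have "\<exists>b\<in>\<int>. a - a ^ p = of_nat p * b" if a: "a \<in> \<int>" for a :: rat
  proof -
    obtain k where k: "a = of_int k" using Ints_cases[OF a] .
    obtain b where "k - k ^ p = of_nat p * b" using fermat_int[OF assms(1)] by blast
    then have "rat_of_int (k - k ^ p) = rat_of_int (of_nat p * b)" by (simp only:)
    then have "a - a ^ p = of_nat p * of_int b" by (simp add: k)
    then show ?thesis by auto
  qed
  ultimately show ?thesis
    using substX_prime[of "\<int>" p f] assms unfolding int_polys_def by blast
qed

section \<open>Excluding denominators\<close>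

text \<open>The preimage in Q[z] of the image of Z[z] in Q[z]/(P). Being bounded means that a fixed
  multiple lies in this set.\<close>

definition integral_mod :: "rat poly \<Rightarrow> rat poly set" where
  "integral_mod P = {g + P * h | g h. g \<in> int_polys}"

lemma integral_modI: "\<lbrakk>x = g + P * h; g \<in> int_polys\<rbrakk> \<Longrightarrow> x \<in> integral_mod P"
  by (auto simp: integral_mod_def)

lemma integral_modE:
  assumes "x \<in> integral_mod P"
  obtains g h where "x = g + P * h" "g \<in> int_polys"
  using assms by (auto simp: integral_mod_def)

lemma comm_subring_add_multiples:
  assumes "comm_subring S"
  shows "comm_subring {x + P * h | x h. x \<in> S}"
proof -
  interpret comm_subring S by fact
  show ?thesis
  proof
    show "1 \<in> {x + P * h | x h. x \<in> S}"
      using one_mem by (force intro: exI[of _ 1] exI[of _ 0])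
  next
    fix x y assume "x \<in> {x + P * h | x h. x \<in> S}" "y \<in> {x + P * h | x h. x \<in> S}"
    then obtain g h g' h' where *: "x = g + P * h" "g \<in> S" "y = g' + P * h'" "g' \<in> S"
      by blast
    then have "x - y = (g - g') + P * (h - h')"
      "x * y = g * g' + P * (g * h' + h * g' + h * P * h')"
      by (auto simp: algebra_simps)
    then show "x - y \<in> {x + P * h | x h. x \<in> S}" "x * y \<in> {x + P * h | x h. x \<in> S}"
      using * by (blast intro: diff_mem mult_mem)+
  qed
qed

lemma comm_subring_integral_mod: "comm_subring (integral_mod P)"
  unfolding integral_mod_def using comm_subring_add_multiples[OF Z.comm_subring_axioms] .

lemma int_polys_subset_integral_mod: "int_polys \<subseteq> integral_mod P"
  by (auto intro!: integral_modI[of _ _ P 0])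

lemma multiple_in_integral_mod: "P * h \<in> integral_mod P"
  by (auto intro!: integral_modI[of _ 0] Z.zero_mem)

lemma integral_mod_mono: "P dvd Q \<Longrightarrow> integral_mod Q \<subseteq> integral_mod P"
  by (auto simp: dvd_def mult.assoc intro: integral_modI elim!: integral_modE)

text \<open>
  If \<open>\<pi>\<^bsup>J+1\<^esup> y\<close> is congruent to an integral \<open>b\<close>, then the bound for \<open>q y\<^sup>p\<close> puts
  \<open>q b\<^sup>p\<close>, and hence \<open>b\<close>, into the ideal \<open>(\<pi>, \<Psi>)\<close>; so \<open>J\<close> already bounds \<open>y\<close>.
\<close>

lemma root_closed_subset_integral_mod:
  assumes \<Psi>: "\<Psi> \<in> int_polys" "lead_coeff \<Psi> = 1"
    and \<pi>: "\<pi> \<in> int_polys" and q: "q \<in> int_polys" and p: "p \<ge> 2"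
    and p_mem: "of_nat p \<in> int_ideal \<pi> \<Psi>"
    and reduced: "\<And>b. \<lbrakk>b \<in> int_polys; q * b ^ p \<in> int_ideal \<pi> \<Psi>\<rbrakk> \<Longrightarrow> b \<in> int_ideal \<pi> \<Psi>"
    and closed: "\<And>y. y \<in> Y \<Longrightarrow> q * y ^ p \<in> Y"
    and bounded: "\<And>y. y \<in> Y \<Longrightarrow> \<pi> ^ J * y \<in> integral_mod \<Psi>"
  shows "Y \<subseteq> integral_mod \<Psi>"
  using bounded
proof (induction J)
  case (Suc J)
  obtain s0 t0 where p0: "of_nat p = \<pi> * s0 + \<Psi> * t0" using p_mem by (elim int_idealE)
  have "\<pi> ^ J * y \<in> integral_mod \<Psi>" if y: "y \<in> Y" for y
  proof -
    obtain b h where b: "\<pi> ^ Suc J * y = b + \<Psi> * h" "b \<in> int_polys"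
      using Suc.prems[OF y] by (elim integral_modE)
    obtain g h' where g: "\<pi> ^ Suc J * (q * y ^ p) = g + \<Psi> * h'" "g \<in> int_polys"
      using Suc.prems[OF closed[OF y]] by (elim integral_modE)
    \<comment> \<open>The surplus exponent of \<open>\<pi>\<close> once one factor
      \<open>\<pi> ^ Suc J\<close> is spent on making \<open>q * y ^ p\<close> integral. It is
      positive because \<open>p \<ge> 2\<close>, which leaves a factor \<open>\<pi>\<close>.\<close>
    define m where "m = Suc J * (p - 1)"
    obtain m' where m': "m = Suc m'" using p unfolding m_def by (cases m) (auto simp: m_def)
    have mp: "Suc J * p = m + Suc J" using p unfolding m_def by (cases p) auto
    have "(b + \<Psi> * h) ^ p = \<pi> ^ (m + Suc J) * y ^ p"
      by (simp only: b(1)[symmetric] power_mult_distrib power_mult[symmetric] mp)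
    then have "q * (b + \<Psi> * h) ^ p = \<pi> ^ m * (\<pi> ^ Suc J * (q * y ^ p))"
      by (simp add: power_add mult_ac)
    also have "\<dots> = \<pi> ^ m * g + \<Psi> * (\<pi> ^ m * h')" unfolding g(1) by (simp add: algebra_simps)
    finally have eq: "q * (b + \<Psi> * h) ^ p = \<pi> ^ m * g + \<Psi> * (\<pi> ^ m * h')" .
    have "\<Psi> dvd (b + \<Psi> * h) ^ p - b ^ p"
      by (simp add: power_diff_sumr2)
    then obtain k where k: "(b + \<Psi> * h) ^ p = b ^ p + \<Psi> * k"
      by (metis add.commute diff_add_cancel dvd_def)
    define t where "t = \<pi> ^ m * h' - q * k"
    have eq2: "q * b ^ p = \<pi> * (\<pi> ^ m' * g) + \<Psi> * t"
      using eq unfolding k t_def m' by (simp add: algebra_simps)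
    \<comment> \<open>So far \<open>t\<close> is only rational; membership in the ideal needs it
      integral, which follows because \<open>\<Psi>\<close> is monic.\<close>
    have "\<Psi> * t = q * b ^ p - \<pi> * (\<pi> ^ m' * g)" using eq2 by simp
    also have "\<dots> \<in> int_polys" by (intro Z.mems q b(2) g(2) \<pi>)
    finally have "t \<in> int_polys" using \<Psi> int_polys_cancel_monic by blast
    then have "b \<in> int_ideal \<pi> \<Psi>"
      by (intro reduced[OF b(2) int_idealI[OF eq2]] Z.mems g(2) \<pi>)
    then obtain s t' where st: "b = \<pi> * s + \<Psi> * t'" "s \<in> int_polys" by (elim int_idealE)
    \<comment> \<open>By \<open>p0\<close>, \<open>\<pi>\<close> is invertible modulo
      \<open>\<Psi>\<close> over the rationals. Since \<open>\<Psi>\<close> divides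
      \<open>\<pi> * u\<close> it therefore divides \<open>u\<close>, and \<open>s\<close> is an
      integral representative of \<open>\<pi> ^ J * y\<close>.\<close>
    define u where "u = \<pi> ^ J * y - s"
    have "\<pi> * u = \<Psi> * (t' + h)"
      using b(1) unfolding u_def st(1) by (simp add: algebra_simps)
    then have eq3: "s0 * (\<pi> * u) = s0 * (\<Psi> * (t' + h))" by (simp only:)
    have "of_nat p * u = s0 * (\<pi> * u) + \<Psi> * (t0 * u)"
      unfolding p0 by (simp add: algebra_simps)
    also have "\<dots> = \<Psi> * (s0 * (t' + h) + t0 * u)"
      unfolding eq3 by (simp add: algebra_simps)
    finally have "of_nat p * u = \<Psi> * (s0 * (t' + h) + t0 * u)" .
    then have "\<Psi> dvd smult (of_nat p) u" by (simp add: of_nat_poly)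
    then have "\<Psi> dvd u" using p by (simp add: dvd_smult_iff)
    then obtain h'' where "u = \<Psi> * h''" by (elim dvdE)
    then show ?thesis using st(2) by (intro integral_modI[of _ s _ h'']) (auto simp: u_def algebra_simps)
  qed
  then show ?case by (rule Suc.IH)
qed auto

section \<open>The polynomials z^r - 1 and reducedness modulo p\<close>

abbreviation unity_poly :: "nat \<Rightarrow> 'a::comm_ring_1 poly" where
  "unity_poly r \<equiv> Polynomial.monom 1 r - 1"

lemma unity_poly_int_polys: "unity_poly r \<in> int_polys"
  by (intro Z.mems monom_int_polys)

lemma monic_unity_poly:
  assumes "r > 0" shows "lead_coeff (unity_poly r :: 'a::comm_ring_1 poly) = 1"
proof -
  have "degree (unity_poly r :: 'a poly) = r"
    using assms by (intro antisym degree_diff_le le_degree) (auto simp: degree_monom_le)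
  then show ?thesis using assms by simp
qed

lemma unity_poly_mult: "(unity_poly (d * k) :: 'a::comm_ring_1 poly) =
    unity_poly d * (\<Sum>i<k. Polynomial.monom 1 (d * i))"
proof -
  have "(unity_poly (d * k) :: 'a poly) = Polynomial.monom 1 d ^ k - 1"
    by (simp add: monom_power mult.commute)
  also have "\<dots> = unity_poly d * (\<Sum>i<k. Polynomial.monom 1 d ^ i)"
    by (rule power_diff_1_eq)
  finally show ?thesis by (simp add: monom_power mult.commute)
qed

lemma unity_poly_mult_int_polys: "\<exists>g\<in>int_polys. unity_poly (d * k) = unity_poly d * g"
  using unity_poly_mult[of d k] by (auto intro!: Z.sum_mem monom_int_polys)

lemma substX_unity_poly: "substX k (unity_poly r) = unity_poly (k * r)"
  by (simp add: pcompose_diff pcompose_1 pcompose_monom_1 monom_power)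

text \<open>Iterates the Frobenius congruence. The second generator \<open>c\<close> is left free
  because both z^m - 1 and \<open>\<Psi>\<close> will take its place.\<close>

lemma int_ideal_prime_power_substX:
  assumes "Factorial_Ring.prime p" "b \<in> int_polys"
  shows "substX (p ^ k) b - b ^ (p ^ k) \<in> int_ideal (of_nat p) c"
proof (induction k)
  case 0
  show ?case using substX_1[of b] by (simp add: int_ideal_gen1[OF Z.zero_mem, of _ c, simplified])
next
  case (Suc k)
  define a where "a = substX (p ^ k) b"
  have a: "a \<in> int_polys" using assms by (simp add: a_def pcompose_monom_int_polys)
  have "substX p a - a ^ p \<in> int_ideal (of_nat p) c"
    using substX_prime_int_polys[OF assms(1) a] int_ideal_gen1 by metis
  moreover have "a ^ p - (b ^ (p ^ k)) ^ p \<in> int_ideal (of_nat p) c"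
    using Suc.IH a assms(2) unfolding a_def by (intro int_ideal_power_diff Z.mems)
  ultimately have "substX p a - a ^ p + (a ^ p - (b ^ (p ^ k)) ^ p) \<in> int_ideal (of_nat p) c"
    by (rule int_ideal_add)
  then show ?case by (simp add: a_def substX_substX power_mult[symmetric] mult.commute)
qed

text \<open>Writing \<open>k = 1 + m * j\<close>, one has z^k - z = z (z^(mj) - 1), so z^k and z
  agree modulo z^m - 1.\<close>

lemma substX_cong_1:
  assumes "b \<in> int_polys" "[k = 1] (mod m)" "k > 0"
  shows "\<exists>g\<in>int_polys. substX k b - b = unity_poly m * g"
  using assms(1)
proof (induction b)
  case (pCons a b)
  then obtain g where g: "g \<in> int_polys" "substX k b - b = unity_poly m * g"
    by (auto simp: int_polys_pCons_iff)
  have b: "b \<in> int_polys" using pCons by (simp add: int_polys_pCons_iff)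
  obtain j where j: "k = Suc (m * j)"
    using assms(2,3) by (metis Suc_eq_plus1 Suc_pred add.commute cong_altdef_nat cong_sym_eq
      dvd_def le_add1 less_eq_Suc_le One_nat_def diff_Suc_1)
  obtain h where h: "h \<in> int_polys" "unity_poly (m * j) = unity_poly m * h"
    using unity_poly_mult_int_polys by blast
  have x: "Polynomial.monom 1 k = Polynomial.monom 1 (m * j) * Polynomial.monom (1::rat) 1"
    by (simp add: j mult_monom)
  have pc: "pCons a b = [:a:] + Polynomial.monom 1 1 * b"
    by (simp add: monom_Suc monom_0)
  have "substX k (pCons a b) - pCons a b =
      Polynomial.monom 1 k * (substX k b - b) + Polynomial.monom 1 1 * b * unity_poly (m * j)"
    unfolding pc by (simp add: pcompose_pCons pcompose_add pcompose_mult pcompose_monom_1)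
      (simp add: x algebra_simps)
  also have "\<dots> = unity_poly m * (Polynomial.monom 1 k * g + Polynomial.monom 1 1 * b * h)"
    unfolding g(2) h(2) by (simp add: algebra_simps)
  finally show ?case
    using g(1) h(1) b by (blast intro: Z.add_mem Z.mult_mem monom_int_polys)
qed (auto intro: Z.zero_mem bexI[of _ 0])

text \<open>By Euler's theorem \<open>p ^ k\<close> is 1 modulo \<open>m\<close> for
  \<open>k = totient m\<close>. Hence modulo (p, z^m - 1) the power \<open>b ^ (p ^ k)\<close>
  equals b(z^(p^k)), which is \<open>b\<close> again; and it is a multiple of
  \<open>b ^ p\<close>.\<close>

lemma reduced_mod_prime:
  assumes "Factorial_Ring.prime p" "coprime p m" "m > 0" "b \<in> int_polys"
    and "b ^ p \<in> int_ideal (of_nat p) (unity_poly m)"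
  shows "b \<in> int_ideal (of_nat p) (unity_poly m)"
proof -
  let ?I = "int_ideal (of_nat p) (unity_poly m)"
  define k where "k = totient m"
  have p: "p > 0" using assms(1) by (rule prime_gt_0_nat)
  have "k > 0" using assms(3) by (simp add: k_def)
  then have "p dvd p ^ k" by (simp add: dvd_power)
  then obtain j where "p ^ k = p * j" by (elim dvdE)
  moreover have "j > 0" using calculation p by (metis gr0I mult_0_right zero_less_power less_irrefl)
  ultimately have "b ^ (p ^ k) = b ^ (p * (j - 1)) * b ^ p"
    by (metis Suc_diff_1 mult_Suc_right power_add mult.commute)
  then have "b ^ (p ^ k) \<in> ?I"
    using assms(4,5) by (auto intro!: int_ideal_mult Z.power_mem)
  from int_ideal_add[OF int_ideal_prime_power_substX[OF assms(1,4), where k = k] this]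
  have "substX (p ^ k) b \<in> ?I" by simp
  moreover have "substX (p ^ k) b - b \<in> ?I"
    using substX_cong_1[OF assms(4) euler_theorem[OF assms(2)]] p int_ideal_gen2
    by (fastforce simp: k_def)
  ultimately have "substX (p ^ k) b - (substX (p ^ k) b - b) \<in> ?I"
    by (rule int_ideal_diff)
  then show ?thesis by simp
qed

text \<open>The quotient \<open>y\<close> must lie in \<open>S\<close> itself. For a subring
  \<open>S\<close> this also gives closure under \<open>substX p\<close>, as
  \<open>substX p x = x ^ p + of_nat p * y\<close>.\<close>

definition frobenius_stable :: "nat \<Rightarrow> rat poly set \<Rightarrow> bool" where
  "frobenius_stable p S \<longleftrightarrow> (\<forall>x\<in>S. \<exists>y\<in>S. substX p x - x ^ p = of_nat p * y)"

text \<open>\<open>root_closed_subset_integral_mod\<close> is applied to the set of all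
  \<open>y\<close> with \<open>D * y \<in> S\<close>. Denominators are measured by
  \<open>\<pi>\<close> instead of \<open>p\<close>, because modulo \<open>p\<close> the polynomial
  \<open>\<Psi>\<close> is a power of \<open>\<pi>\<close> and Z[z]/(p, \<open>\<Psi>\<close>) is in
  general not reduced, whereas Z[z]/(\<open>\<pi>\<close>, \<open>\<Psi>\<close>) = Z[z]/(p,
  \<open>\<pi>\<close>) is.\<close>

lemma prime_local_step:
  assumes p: "Factorial_Ring.prime p" and cop: "coprime p m" "m > 0"
    and d: "d = p ^ n * m" and r: "r = d * p"
    and S: "comm_subring S" "int_polys \<subseteq> S" "\<And>h. unity_poly r * h \<in> S"
    and frob: "frobenius_stable p S"
    and bounded: "\<And>x. x \<in> S \<Longrightarrow> of_nat (p ^ c) * x \<in> integral_mod (unity_poly r)"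
    and y: "unity_poly d * y \<in> S"
  shows "y \<in> integral_mod (\<Sum>i<p. Polynomial.monom 1 (d * i))"
proof -
  define \<Psi> :: "rat poly" where "\<Psi> = (\<Sum>i<p. Polynomial.monom 1 (d * i))"
  define D :: "rat poly" where "D = unity_poly d"
  define \<pi> :: "rat poly" where "\<pi> = unity_poly m"
  interpret S: comm_subring S by fact
  have p2: "p \<ge> 2" using p by (rule prime_ge_2_nat)
  have dpos: "d > 0" using d cop p2 by simp
  have ints: "\<Psi> \<in> int_polys" "D \<in> int_polys" "\<pi> \<in> int_polys"
    unfolding \<Psi>_def D_def \<pi>_def by (intro Z.sum_mem monom_int_polys unity_poly_int_polys)+
  have r_eq: "unity_poly r = D * \<Psi>" unfolding r D_def \<Psi>_def by (rule unity_poly_mult)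
  have monic_D: "lead_coeff D = 1" unfolding D_def using dpos by (rule monic_unity_poly)
  have D0: "D \<noteq> 0" using monic_D by auto
  have "lead_coeff (D * \<Psi>) = 1"
    unfolding r_eq[symmetric] using r dpos p2 by (intro monic_unity_poly) simp
  then have monic: "lead_coeff \<Psi> = 1" using monic_D by (simp add: lead_coeff_mult)
  have monic_pi: "lead_coeff \<pi> = 1" unfolding \<pi>_def using cop(2) by (rule monic_unity_poly)

  \<comment> \<open>Expanding z^r = (D + 1)^p gives
    \<open>D * \<Psi> = D ^ p + of_nat p * w\<close>; cancelling the monic \<open>D\<close> keeps
    the quotient integral.\<close>
  have "\<exists>q\<in>int_polys. \<Psi> = D ^ (p - 1) + of_nat p * q"
  proof -
    obtain w where w: "w \<in> int_polys" "(D + 1) ^ p = D ^ p + 1 ^ p + of_nat p * w"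
      using Z.power_prime_add[OF p ints(2) Z.one_mem] .
    have "(D + 1) ^ p = Polynomial.monom 1 r"
      by (simp add: D_def r monom_power mult.commute)
    then have "D * \<Psi> = (D + 1) ^ p - 1" by (simp flip: r_eq)
    then have "D * \<Psi> = D ^ p + of_nat p * w" using w(2) by simp
    moreover have "D ^ p = D * D ^ (p - 1)" using p2 by (cases p) auto
    ultimately have eq: "D * (\<Psi> - D ^ (p - 1)) = of_nat p * w" by (simp add: algebra_simps)
    define q where "q = smult (1 / of_nat p) (\<Psi> - D ^ (p - 1))"
    have "D * q = w" using eq p2 by (simp add: q_def of_nat_poly)
    then have "q \<in> int_polys" using int_polys_cancel_monic[OF _ ints(2) monic_D] w(1) by blast
    moreover have "\<Psi> = D ^ (p - 1) + of_nat p * q" using p2 by (simp add: q_def of_nat_poly)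
    ultimately show ?thesis by blast
  qed
  then obtain q where q: "q \<in> int_polys" "\<Psi> = D ^ (p - 1) + of_nat p * q" by blast

  have D_pi: "\<exists>g\<in>int_polys. unity_poly (d * k) = \<pi> * g" for k
    using unity_poly_mult_int_polys[of m "p ^ n * k"] by (simp add: \<pi>_def d mult_ac)
  \<comment> \<open>Each of the \<open>p\<close> summands z^(di) of \<open>\<Psi>\<close> is 1
    modulo \<open>\<pi>\<close>, since \<open>m\<close> divides \<open>d\<close>.\<close>
  have "\<exists>g\<in>int_polys. \<Psi> = of_nat p + \<pi> * g"
  proof -
    obtain g where g: "\<And>k. g k \<in> int_polys" "\<And>k. unity_poly (d * k) = \<pi> * g k"
      using D_pi by metis
    have "\<Psi> = (\<Sum>i<p. 1 + \<pi> * g i)" unfolding \<Psi>_def by (intro sum.cong) (auto simp flip: g(2))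
    then show ?thesis
      using g(1) by (intro bexI[of _ "sum g {..<p}"] Z.sum_mem) (auto simp: sum.distrib sum_distrib_left)
  qed
  then obtain g where g: "g \<in> int_polys" "\<Psi> = of_nat p + \<pi> * g" by blast
  obtain g1 where g1: "g1 \<in> int_polys" "D = \<pi> * g1" using D_pi[of 1] by (auto simp: D_def)
  \<comment> \<open>Compare the two expressions for \<open>\<Psi>\<close>: as \<open>\<pi>\<close>
    divides \<open>D\<close>, it divides \<open>of_nat p * (q - 1)\<close>. The factor
    \<open>p\<close> is removed over the rationals, and the cofactor is integral because
    \<open>\<pi>\<close> is monic.\<close>
  have "\<exists>g\<in>int_polys. q = 1 + \<pi> * g"
  proof -
    obtain j where j: "p - 1 = Suc j" using p2 by (cases "p - 1") auto
    define u where "u = g - g1 * D ^ j"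
    have "u \<in> int_polys" unfolding u_def by (intro Z.mems g g1 ints)
    have eq: "of_nat p * (q - 1) = \<pi> * u"
      using q(2) unfolding u_def g(2) j by (simp add: g1(2) algebra_simps)
    define v where "v = smult (1 / of_nat p) u"
    have "q - 1 = smult (1 / of_nat p) (of_nat p * (q - 1))" using p2 by (simp add: of_nat_poly)
    then have v: "q - 1 = \<pi> * v" unfolding eq v_def by simp
    have "\<pi> * v \<in> int_polys" unfolding v[symmetric] by (intro Z.mems q)
    then have "v \<in> int_polys" using int_polys_cancel_monic[OF _ ints(3) monic_pi] by blast
    then show ?thesis using v by (intro bexI[of _ v]) (auto simp: algebra_simps)
  qed
  then obtain v where v: "v \<in> int_polys" "q = 1 + \<pi> * v" by blast

  have p_mem: "of_nat p \<in> int_ideal \<pi> \<Psi>"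
    by (rule int_idealI[of _ _ "- g" _ 1]) (auto simp: g(2) intro: Z.mems g)
  have pi_mem: "\<pi> \<in> int_ideal \<pi> \<Psi>" "\<pi> \<in> int_ideal (of_nat p) \<pi>"
    using int_ideal_gen1[OF Z.one_mem, of \<pi> \<Psi>] int_ideal_gen2[OF Z.one_mem, of \<pi>] by simp_all
  have Psi_mem: "\<Psi> \<in> int_ideal (of_nat p) \<pi>"
    by (rule int_idealI[of _ _ 1 _ g]) (auto simp: g(2) intro: Z.mems g)

  \<comment> \<open>The ideals (\<open>\<pi>\<close>, \<open>\<Psi>\<close>) and (p,
    \<open>\<pi>\<close>) coincide, and \<open>q\<close> is 1 modulo \<open>\<pi>\<close>, so this
    is \<open>reduced_mod_prime\<close>.\<close>
  have reduced: "b \<in> int_ideal \<pi> \<Psi>" if b: "b \<in> int_polys" "q * b ^ p \<in> int_ideal \<pi> \<Psi>" for b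
  proof -
    have "q * b ^ p \<in> int_ideal (of_nat p) \<pi>"
      using b(2) int_ideal_subset[OF pi_mem(2) Psi_mem] by blast
    moreover have "\<pi> * (v * b ^ p) \<in> int_ideal (of_nat p) \<pi>"
      by (intro int_ideal_gen2 Z.mems v b)
    ultimately have "q * b ^ p - \<pi> * (v * b ^ p) \<in> int_ideal (of_nat p) \<pi>"
      by (rule int_ideal_diff)
    then have "b ^ p \<in> int_ideal (of_nat p) \<pi>" by (simp add: v(2) algebra_simps)
    then have "b \<in> int_ideal (of_nat p) \<pi>"
      unfolding \<pi>_def by (rule reduced_mod_prime[OF p cop b(1)])
    then show ?thesis using int_ideal_subset[OF p_mem pi_mem(1)] by blast
  qed

  \<comment> \<open>Since D(z^p) = z^r - 1, the image of \<open>D * y\<close> under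
    \<open>substX p\<close> is a multiple of z^r - 1. Such multiples lie in \<open>S\<close> and may
    be divided by \<open>p\<close> at will, so \<open>frob\<close> effectively puts
    \<open>(D * y) ^ p / p\<close> into \<open>S\<close>; up to another such multiple this is
    \<open>- D * (q * y ^ p)\<close>.\<close>
  have closed: "D * (q * y ^ p) \<in> S" if y: "D * y \<in> S" for y
  proof -
    obtain u where u: "u \<in> S" "substX p (D * y) - (D * y) ^ p = of_nat p * u"
      using frob y by (auto simp: frobenius_stable_def)
    have s: "substX p (D * y) = unity_poly r * substX p y"
      unfolding pcompose_mult D_def substX_unity_poly r mult.commute[of p] ..
    have Dp: "(D * y) ^ p = D * D ^ (p - 1) * y ^ p"
      using p2 by (cases p) (auto simp: power_mult_distrib)
    define h where "h = smult (1 / of_nat p) (y ^ p - substX p y)"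
    have h: "of_nat p * h = y ^ p - substX p y" using p2 by (simp add: h_def of_nat_poly)
    have "of_nat p * (D * (q * y ^ p)) = D * (\<Psi> - D ^ (p - 1)) * y ^ p"
      by (simp add: q(2) algebra_simps)
    also have "\<dots> = unity_poly r * y ^ p - (D * y) ^ p" unfolding r_eq Dp by (simp add: algebra_simps)
    also have "\<dots> = unity_poly r * (y ^ p - substX p y) + (substX p (D * y) - (D * y) ^ p)"
      unfolding s by (simp add: algebra_simps)
    also have "\<dots> = of_nat p * (unity_poly r * h + u)" unfolding u(2) h[symmetric] by (simp add: algebra_simps)
    finally have "D * (q * y ^ p) = unity_poly r * h + u" using p2 by simp
    then show ?thesis using S.add_mem[OF S(3) u(1)] by simp
  qed

  \<comment> \<open>Modulo \<open>p\<close>, \<open>D\<close> is \<open>\<pi> ^ (p ^ n)\<close>, and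
    \<open>D ^ (p - 1)\<close> lies in (p, \<open>\<Psi>\<close>) by the formula defining
    \<open>q\<close>. So \<open>e = p ^ n * (p - 1)\<close> works.\<close>
  have "\<exists>e. \<pi> ^ e \<in> int_ideal (of_nat p) \<Psi>"
  proof -
    let ?I = "int_ideal (of_nat p) \<Psi>"
    have "D ^ (p - 1) \<in> ?I"
      by (rule int_idealI[of _ _ "- q" _ 1]) (auto simp: q(2) intro: Z.mems q)
    moreover have "\<pi> ^ (p ^ n) - D \<in> ?I"
    proof -
      have "substX (p ^ n) \<pi> - \<pi> ^ (p ^ n) \<in> ?I" using p ints by (intro int_ideal_prime_power_substX)
      then have "- 1 * (substX (p ^ n) \<pi> - \<pi> ^ (p ^ n)) \<in> ?I" by (intro int_ideal_mult Z.mems)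
      then show ?thesis by (simp add: \<pi>_def D_def d substX_unity_poly)
    qed
    then have "(\<pi> ^ (p ^ n)) ^ (p - 1) - D ^ (p - 1) \<in> ?I"
      using ints by (intro int_ideal_power_diff Z.mems)
    ultimately have "(\<pi> ^ (p ^ n)) ^ (p - 1) - D ^ (p - 1) + D ^ (p - 1) \<in> ?I"
      by (intro int_ideal_add)
    then show ?thesis by (auto simp flip: power_mult)
  qed
  then obtain e s t where e: "\<pi> ^ e = of_nat p * s + \<Psi> * t" "s \<in> int_polys" "t \<in> int_polys"
    by (metis int_idealE)
  \<comment> \<open>Converts the bound by \<open>p ^ c\<close> into one by a power of
    \<open>\<pi>\<close>: modulo \<open>\<Psi>\<close>, \<open>\<pi> ^ (e * c)\<close> is a multiple
    of \<open>p ^ c\<close>.\<close>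
  have bound: "\<pi> ^ (e * c) * y \<in> integral_mod \<Psi>" if y: "D * y \<in> S" for y
  proof -
    obtain g0 h where gh: "of_nat (p ^ c) * (D * y) = g0 + unity_poly r * h" "g0 \<in> int_polys"
      using bounded[OF y] by (elim integral_modE)
    have "D * (of_nat (p ^ c) * y - \<Psi> * h) = g0"
      using gh(1) unfolding r_eq by (simp add: algebra_simps)
    then have g0: "of_nat (p ^ c) * y - \<Psi> * h \<in> int_polys"
      using int_polys_cancel_monic[OF _ ints(2) monic_D] gh(2) by blast
    have "\<Psi> dvd (of_nat p * s + \<Psi> * t) ^ c - (of_nat p * s) ^ c"
      by (simp add: power_diff_sumr2)
    then obtain k where "(of_nat p * s + \<Psi> * t) ^ c = (of_nat p * s) ^ c + \<Psi> * k"
      by (metis add.commute diff_add_cancel dvd_def)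
    then have k: "\<pi> ^ (e * c) = (of_nat p * s) ^ c + \<Psi> * k"
      by (simp add: power_mult e(1))
    have "\<pi> ^ (e * c) * y = s ^ c * (of_nat (p ^ c) * y - \<Psi> * h) + \<Psi> * (s ^ c * h + k * y)"
      unfolding k by (simp add: power_mult_distrib algebra_simps)
    then show ?thesis by (rule integral_modI) (intro Z.mems g0 e)
  qed

  have "{y. D * y \<in> S} \<subseteq> integral_mod \<Psi>"
    using root_closed_subset_integral_mod[OF ints(1) monic ints(3) q(1) p2 p_mem reduced, of "{y. D * y \<in> S}" "e * c"]
      closed bound by blast
  then show ?thesis using y by (auto simp: D_def \<Psi>_def)
qed

text \<open>In the inductive step \<open>S\<close> is enlarged to \<open>T\<close>, the preimage of
  its image in Q[z]/(z^d - 1), to which the induction hypothesis applies. What remains is a multiple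
  of z^d - 1, treated by \<open>prime_local_step\<close>.\<close>

lemma prime_local_maximality:
  assumes p: "Factorial_Ring.prime p" and cop: "coprime p m" "m > 0"
    and S: "comm_subring S" "int_polys \<subseteq> S" "\<And>h. unity_poly (p ^ n * m) * h \<in> S"
    and frob: "frobenius_stable p S"
    and bounded: "\<And>x. x \<in> S \<Longrightarrow> of_nat (p ^ c) * x \<in> integral_mod (unity_poly (p ^ n * m))"
  shows "S \<subseteq> integral_mod (unity_poly (p ^ n * m))"
  using S frob bounded
proof (induction n arbitrary: S)
  case 0
  interpret S: comm_subring S by fact
  have p2: "p \<ge> 2" using p by (rule prime_ge_2_nat)
  have p_mem: "of_nat p \<in> int_ideal (of_nat p) (unity_poly m)"
    using int_ideal_gen1[OF Z.one_mem, of "of_nat p"] by simp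
  \<comment> \<open>Here \<open>\<pi> = p\<close>, \<open>q = 1\<close> and \<open>Y = S\<close>,
    which is closed under \<open>p\<close>-th powers as a subring.\<close>
  have "S \<subseteq> integral_mod (unity_poly m)"
    by (rule root_closed_subset_integral_mod[OF unity_poly_int_polys monic_unity_poly[OF cop(2)] Z.of_nat_mem
          Z.one_mem p2 p_mem, where J = c])
      (use reduced_mod_prime[OF p cop] 0 S.power_mem in auto)
  then show ?case by simp
next
  case (Suc n)
  define d where "d = p ^ n * m"
  have r: "p ^ Suc n * m = d * p" by (simp add: d_def)
  note prems = Suc.prems[unfolded r]
  interpret S: comm_subring S by fact
  define T where "T = {x + unity_poly d * h | x h. x \<in> S}"
  have ST: "S \<subseteq> T" unfolding T_def by (force intro: exI[of _ 0])
  have "T \<subseteq> integral_mod (unity_poly (p ^ n * m))"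
  proof (rule Suc.IH)
    show "comm_subring T" unfolding T_def using prems(1) by (rule comm_subring_add_multiples)
    show "int_polys \<subseteq> T" using prems(2) ST by blast
    show "unity_poly (p ^ n * m) * h \<in> T" for h
      unfolding T_def d_def using S.zero_mem by force
    show "frobenius_stable p T"
      unfolding frobenius_stable_def
    proof
      fix x assume "x \<in> T"
      then obtain x' h where x: "x = x' + unity_poly d * h" "x' \<in> S" by (auto simp: T_def)
      obtain y where y: "y \<in> S" "substX p x' - x' ^ p = of_nat p * y"
        using prems(4) x(2) by (auto simp: frobenius_stable_def)
      \<comment> \<open>Changing \<open>x'\<close> by a multiple of z^d - 1 changes both terms of
        the congruence by such multiples, and these stay in \<open>T\<close> after division by
        \<open>p\<close>.\<close>
      have "unity_poly d dvd x ^ p - x' ^ p"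
        unfolding x(1) by (simp add: power_diff_sumr2)
      moreover have "unity_poly d dvd substX p (unity_poly d * h)"
        unfolding pcompose_mult substX_unity_poly mult.commute[of p] unity_poly_mult by (intro dvd_mult2 dvd_triv_left)
      ultimately have "unity_poly d dvd substX p (unity_poly d * h) - (x ^ p - x' ^ p)" by (rule dvd_diff[rotated])
      then obtain k where k: "substX p (unity_poly d * h) - (x ^ p - x' ^ p) = unity_poly d * k" by (elim dvdE)
      have "substX p x - x ^ p = of_nat p * y + unity_poly d * k"
        unfolding k[symmetric] y(2)[symmetric] by (simp add: x(1) pcompose_add)
      also have "k = of_nat p * smult (1 / of_nat p) k"
        using prime_gt_0_nat[OF p] by (simp add: of_nat_poly)
      also have "of_nat p * y + unity_poly d * (of_nat p * smult (1 / of_nat p) k) =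
          of_nat p * (y + unity_poly d * smult (1 / of_nat p) k)"
        by (simp only: distrib_left mult_ac)
      finally have "substX p x - x ^ p = of_nat p * (y + unity_poly d * smult (1 / of_nat p) k)" .
      moreover have "y + unity_poly d * smult (1 / of_nat p) k \<in> T"
        unfolding T_def using y(1) by blast
      ultimately show "\<exists>y\<in>T. substX p x - x ^ p = of_nat p * y" by blast
    qed
    show "of_nat (p ^ c) * x \<in> integral_mod (unity_poly (p ^ n * m))" if xT: "x \<in> T" for x
    proof -
      obtain x' h where x: "x = x' + unity_poly d * h" "x' \<in> S" using xT by (auto simp: T_def)
      interpret M: comm_subring "integral_mod (unity_poly d)" by (rule comm_subring_integral_mod)
      have "integral_mod (unity_poly (d * p)) \<subseteq> integral_mod (unity_poly d)"
        by (rule integral_mod_mono) (simp add: unity_poly_mult)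
      then have "of_nat (p ^ c) * x' \<in> integral_mod (unity_poly d)" using prems(5)[OF x(2)] by blast
      then have "of_nat (p ^ c) * x' + unity_poly d * (of_nat (p ^ c) * h) \<in> integral_mod (unity_poly d)"
        by (intro M.add_mem multiple_in_integral_mod)
      then show ?thesis by (simp add: x(1) d_def algebra_simps)
    qed
  qed
  then have T: "T \<subseteq> integral_mod (unity_poly d)" by (simp add: d_def)
  show ?case
    unfolding r
  proof
    fix x assume x: "x \<in> S"
    then obtain g y where g: "x = g + unity_poly d * y" "g \<in> int_polys"
      using ST T by (meson integral_modE subsetD)
    \<comment> \<open>Subtracting the integral part stays inside \<open>S\<close>, so the local step
      applies to \<open>y\<close>; its integral part and z^(dp) - 1 = (z^d - 1)
      \<open>\<Psi>\<close> then give the claim for \<open>x\<close>.\<close>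
    have "unity_poly d * y = x - g" by (simp add: g(1))
    also have "\<dots> \<in> S" using x g(2) prems(2) by (intro S.diff_mem) auto
    finally have "y \<in> integral_mod (\<Sum>i<p. Polynomial.monom 1 (d * i))"
      by (intro prime_local_step[OF p cop d_def refl prems(1-5)])
    then obtain g' h where g': "y = g' + (\<Sum>i<p. Polynomial.monom 1 (d * i)) * h" "g' \<in> int_polys"
      by (elim integral_modE)
    have "x = (g + unity_poly d * g') + unity_poly (d * p) * h"
      unfolding g(1) g'(1) unity_poly_mult[of d p] by (simp add: algebra_simps)
    then show "x \<in> integral_mod (unity_poly (d * p))"
      by (rule integral_modI) (intro Z.mems g g' unity_poly_int_polys)
  qed
qed

section \<open>Adjoining the root of unity\<close>

text \<open>The products-and-sums set A Z[z], which is the ring A[z] if \<open>A\<close> is a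
  subring. A model need not contain z, while the local argument requires all of Z[z]. The inductive
  form allows induction on the number of summands.\<close>

inductive_set compositum :: "rat poly set \<Rightarrow> rat poly set" for A where
  zero: "0 \<in> compositum A"
| step: "\<lbrakk>a \<in> A; g \<in> int_polys; x \<in> compositum A\<rbrakk> \<Longrightarrow> a * g + x \<in> compositum A"

lemma comm_subring_compositum:
  assumes "comm_subring A"
  shows "comm_subring (compositum A)"
proof -
  interpret A: comm_subring A by fact
  have add: "x + y \<in> compositum A" if "x \<in> compositum A" "y \<in> compositum A" for x y
    using that by (induction x) (auto simp: add.assoc intro: compositum.step)
  have minus: "- x \<in> compositum A" if "x \<in> compositum A" for x
    using that
  proof induction
    case (step a g x)
    then have "(- a) * g + - x \<in> compositum A" by (intro compositum.step A.uminus_mem)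
    then show ?case by simp
  qed (auto intro: compositum.zero)
  have scale: "a * g * x \<in> compositum A" if "x \<in> compositum A" "a \<in> A" "g \<in> int_polys" for x a g
    using that(1)
  proof induction
    case (step b h x)
    then have "(a * b) * (g * h) + a * g * x \<in> compositum A"
      using that by (intro compositum.step A.mems Z.mems)
    then show ?case by (simp add: algebra_simps)
  qed (auto intro: compositum.zero)
  have mult: "x * y \<in> compositum A" if "x \<in> compositum A" "y \<in> compositum A" for x y
    using that(1)
  proof induction
    case (step a g x)
    then show ?case using that(2) scale add by (auto simp: distrib_right)
  qed (auto intro: compositum.zero)
  show ?thesis
  proof
    show "1 \<in> compositum A"
      using compositum.step[OF A.one_mem Z.one_mem compositum.zero] by simp
    show "x - y \<in> compositum A" if "x \<in> compositum A" "y \<in> compositum A" for x y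
      using add[OF that(1) minus[OF that(2)]] by simp
  qed (rule mult)
qed

lemma subset_compositum: "A \<subseteq> compositum A"
proof
  fix a assume "a \<in> A"
  then have "a * 1 + 0 \<in> compositum A" by (intro compositum.intros Z.one_mem)
  then show "a \<in> compositum A" by simp
qed

lemma int_polys_subset_compositum:
  assumes "comm_subring A"
  shows "int_polys \<subseteq> compositum A"
proof
  fix g assume "g \<in> int_polys"
  then have "1 * g + 0 \<in> compositum A"
    using comm_subring.one_mem[OF assms] by (intro compositum.intros)
  then show "g \<in> compositum A" by simp
qed

text \<open>Substitution and \<open>p\<close>-th power are multiplicative, and additive up to
  \<open>p\<close> times an element of the ring, so the congruence passes from \<open>A\<close> and
  Z[z] to sums of products.\<close>

lemma frobenius_stable_compositum:
  assumes "comm_subring A" "Factorial_Ring.prime p" "frobenius_stable p A"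
  shows "frobenius_stable p (compositum A)"
  unfolding frobenius_stable_def
proof
  interpret C: comm_subring "compositum A" using assms(1) by (rule comm_subring_compositum)
  fix x assume "x \<in> compositum A"
  then show "\<exists>y\<in>compositum A. substX p x - x ^ p = of_nat p * y"
  proof induction
    case zero
    then show ?case using assms(2) by (auto simp: prime_gt_0_nat power_0_left intro!: bexI[of _ 0] C.zero_mem)
  next
    case (step a g x)
    obtain y where y: "y \<in> compositum A" "substX p x - x ^ p = of_nat p * y"
      using step.IH by blast
    obtain a1 where a1: "a1 \<in> A" "substX p a - a ^ p = of_nat p * a1"
      using assms(3) step.hyps(1) by (auto simp: frobenius_stable_def)
    obtain g1 where g1: "g1 \<in> int_polys" "substX p g - g ^ p = of_nat p * g1"
      using substX_prime_int_polys[OF assms(2) step.hyps(2)] by blast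
    have in_C: "a \<in> compositum A" "a1 \<in> compositum A" "g \<in> compositum A" "g1 \<in> compositum A"
      "substX p g \<in> compositum A"
      using subset_compositum[of A] int_polys_subset_compositum[OF assms(1)]
        step.hyps a1 g1 pcompose_monom_int_polys by blast+
    obtain w where w: "w \<in> compositum A" "(a * g + x) ^ p = (a * g) ^ p + x ^ p + of_nat p * w"
      using C.power_prime_add[OF assms(2) C.mult_mem[OF in_C(1,3)] step.hyps(3)] .
    have "substX p (a * g + x) - (a * g + x) ^ p =
        (substX p a - a ^ p) * substX p g + a ^ p * (substX p g - g ^ p) + (substX p x - x ^ p) - of_nat p * w"
      unfolding w(2) by (simp add: pcompose_add pcompose_mult power_mult_distrib algebra_simps)
    also have "\<dots> = of_nat p * (a1 * substX p g + a ^ p * g1 + y - w)"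
      unfolding a1(2) g1(2) y(2) by (simp add: algebra_simps)
    finally show ?case
      by (intro bexI[of _ "a1 * substX p g + a ^ p * g1 + y - w"] C.mems in_C y w)
  qed
qed

text \<open>Integral factors introduce no denominators, so the bound \<open>N\<close> for
  \<open>A\<close> persists.\<close>

lemma integral_mod_compositum:
  assumes "\<And>x. x \<in> A \<Longrightarrow> of_nat N * x \<in> integral_mod P" "x \<in> compositum A"
  shows "of_nat N * x \<in> integral_mod P"
  using assms(2)
proof induction
  interpret M: comm_subring "integral_mod P" by (rule comm_subring_integral_mod)
  case (step a g x)
  have "g \<in> integral_mod P" using step.hyps(2) int_polys_subset_integral_mod by blast
  then have "of_nat N * a * g + of_nat N * x \<in> integral_mod P"
    by (intro M.add_mem[OF M.mult_mem[OF assms(1)[OF step.hyps(1)]] step.IH])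
  then show ?case by (simp add: algebra_simps)
qed (use int_polys_subset_integral_mod Z.zero_mem in auto)

section \<open>Reduction to a single prime\<close>

lemma substX_integral_mod:
  assumes "x \<in> integral_mod (unity_poly r)"
  shows "substX p x \<in> integral_mod (unity_poly r)"
proof -
  obtain g h where x: "x = g + unity_poly r * h" "g \<in> int_polys" using assms by (elim integral_modE)
  have "substX p x = substX p g + unity_poly r * ((\<Sum>i<p. Polynomial.monom 1 (r * i)) * substX p h)"
    unfolding x(1) pcompose_add pcompose_mult substX_unity_poly mult.commute[of p] unity_poly_mult
    by (simp only: mult.assoc)
  then show ?thesis by (rule integral_modI) (rule pcompose_monom_int_polys[OF x(2)])
qed

lemma coprime_multiples_in_subring:
  assumes "comm_subring S" "of_nat a * x \<in> S" "of_nat b * x \<in> S" "coprime a b"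
  shows "x \<in> S"
proof -
  interpret comm_subring S by fact
  have "coprime (int a) (int b)" using assms(4) by simp
  then obtain u v where uv: "u * int a + v * int b = 1" by (metis bezout_int coprime_imp_gcd_eq_1)
  have "of_int u * (of_nat a * x) + of_int v * (of_nat b * x) = of_int (u * int a + v * int b) * x"
    by (simp add: algebra_simps)
  then have "of_int u * (of_nat a * x) + of_int v * (of_nat b * x) = x" by (simp add: uv)
  then show ?thesis using assms by (metis add_mem mult_mem of_int_mem)
qed

text \<open>\<open>prime_local_maximality\<close> is applied to the part \<open>T\<close> of A[z]
  whose denominators are powers of \<open>p\<close>; there the \<open>p\<close>-part
  \<open>p ^ c\<close> of \<open>N\<close> is already a bound.\<close>

lemma p_saturated_compositum:
  assumes p: "Factorial_Ring.prime p" and r: "r > 0"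
    and A: "comm_subring A" "\<And>h. unity_poly r * h \<in> A"
    and frob: "frobenius_stable p A"
    and N: "N > 0" and bounded: "\<And>x. x \<in> A \<Longrightarrow> of_nat N * x \<in> integral_mod (unity_poly r)"
    and x: "x \<in> compositum A" "of_nat p * x \<in> integral_mod (unity_poly r)"
  shows "x \<in> integral_mod (unity_poly r)"
proof -
  interpret M: comm_subring "integral_mod (unity_poly r)" by (rule comm_subring_integral_mod)
  interpret C: comm_subring "compositum A" using A(1) by (rule comm_subring_compositum)
  define T where "T = {x \<in> compositum A. \<exists>i. of_nat (p ^ i) * x \<in> integral_mod (unity_poly r)}"
  obtain m n where m: "\<not> p dvd m" "r = m * p ^ n"
    using prime_power_canonical[OF p r] by blast
  have r_eq: "r = p ^ n * m" using m by simp
  have cop: "coprime p m" "m > 0"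
    using p m r by (auto intro: prime_imp_coprime)
  obtain N' c where N': "\<not> p dvd N'" "N = N' * p ^ c"
    using prime_power_canonical[OF p N] by blast
  have "T \<subseteq> integral_mod (unity_poly (p ^ n * m))"
  proof (rule prime_local_maximality[OF p cop])
    show "comm_subring T"
    proof
      have "of_nat (p ^ 0) * 1 \<in> integral_mod (unity_poly r)" using M.one_mem by simp
      then show "1 \<in> T" unfolding T_def using C.one_mem by blast
    next
      fix x y assume "x \<in> T" "y \<in> T"
      then obtain i j where *: "x \<in> compositum A" "y \<in> compositum A"
        "of_nat (p ^ i) * x \<in> integral_mod (unity_poly r)" "of_nat (p ^ j) * y \<in> integral_mod (unity_poly r)"
        by (auto simp: T_def)
      have "of_nat (p ^ j) * (of_nat (p ^ i) * x) - of_nat (p ^ i) * (of_nat (p ^ j) * y) \<in> integral_mod (unity_poly r)"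
        "of_nat (p ^ i) * x * (of_nat (p ^ j) * y) \<in> integral_mod (unity_poly r)"
        by (intro M.diff_mem M.mult_mem[OF M.of_nat_mem] *(3,4), rule M.mult_mem[OF *(3,4)])
      then have "of_nat (p ^ (i + j)) * (x - y) \<in> integral_mod (unity_poly r)"
        "of_nat (p ^ (i + j)) * (x * y) \<in> integral_mod (unity_poly r)"
        by (simp_all add: algebra_simps power_add)
      then show "x - y \<in> T" "x * y \<in> T"
        unfolding T_def using *(1,2) C.diff_mem C.mult_mem by blast+
    qed
    have sub: "x \<in> T" if "x \<in> compositum A" "x \<in> integral_mod (unity_poly r)" for x
      unfolding T_def using that by (auto intro!: exI[of _ 0])
    show "int_polys \<subseteq> T"
      using sub int_polys_subset_compositum[OF A(1)] int_polys_subset_integral_mod by blast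
    show "unity_poly (p ^ n * m) * h \<in> T" for h
      unfolding r_eq[symmetric] using sub A(2) subset_compositum multiple_in_integral_mod by blast
    show "frobenius_stable p T"
      unfolding frobenius_stable_def
    proof
      fix x assume "x \<in> T"
      then obtain i where i: "x \<in> compositum A" "of_nat (p ^ i) * x \<in> integral_mod (unity_poly r)"
        by (auto simp: T_def)
      obtain y where y: "y \<in> compositum A" "substX p x - x ^ p = of_nat p * y"
        using frobenius_stable_compositum[OF A(1) p frob] i(1) by (auto simp: frobenius_stable_def)
      have s: "substX p (of_nat (p ^ i) * x) = of_nat (p ^ i) * substX p x"
        by (simp add: of_nat_poly pcompose_mult pcompose_smult)
      have "i * p = i * (p - 1) + i" using prime_gt_0_nat[OF p] by (cases p) auto
      then have e: "(of_nat (p ^ (i * p)) :: rat poly) = of_nat (p ^ (i * (p - 1))) * of_nat (p ^ i)"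
        by (simp only: power_add of_nat_mult)
      have e': "(of_nat (p ^ i) * x) ^ p = of_nat (p ^ (i * p)) * x ^ p"
        by (simp add: power_mult_distrib power_mult)
      \<comment> \<open>The power of \<open>p\<close> is chosen so that the right-hand side is built
        from the integral element \<open>of_nat (p ^ i) * x\<close> alone; hence the Frobenius
        quotient \<open>y\<close> again has a \<open>p\<close>-power denominator.\<close>
      have "of_nat (p ^ (i * p + 1)) * y = of_nat (p ^ (i * p)) * (substX p x - x ^ p)"
        unfolding y(2) by simp
      also have "\<dots> = of_nat (p ^ (i * (p - 1))) * substX p (of_nat (p ^ i) * x) - (of_nat (p ^ i) * x) ^ p"
        unfolding s e' by (simp only: e right_diff_distrib mult.assoc)
      also have "\<dots> \<in> integral_mod (unity_poly r)"
        by (intro M.diff_mem M.mult_mem[OF M.of_nat_mem] M.power_mem substX_integral_mod i(2))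
      finally have "y \<in> T" unfolding T_def using y(1) by blast
      then show "\<exists>y\<in>T. substX p x - x ^ p = of_nat p * y" using y(2) by blast
    qed
    show "of_nat (p ^ c) * x \<in> integral_mod (unity_poly (p ^ n * m))" if xT: "x \<in> T" for x
    proof -
      obtain i where i: "x \<in> compositum A" "of_nat (p ^ i) * x \<in> integral_mod (unity_poly r)"
        using xT by (auto simp: T_def)
      \<comment> \<open>Both \<open>N'\<close> and \<open>p ^ i\<close> carry
        \<open>of_nat (p ^ c) * x\<close> into the integral elements; being coprime, they yield the
        bound by a Bezout relation.\<close>
      have "of_nat N * x \<in> integral_mod (unity_poly r)"
        using bounded i(1) by (rule integral_mod_compositum)
      then have "of_nat N' * (of_nat (p ^ c) * x) \<in> integral_mod (unity_poly r)"
        by (simp add: N'(2) mult.assoc)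
      moreover have "of_nat (p ^ c) * (of_nat (p ^ i) * x) \<in> integral_mod (unity_poly r)"
        by (rule M.mult_mem[OF M.of_nat_mem i(2)])
      then have "of_nat (p ^ i) * (of_nat (p ^ c) * x) \<in> integral_mod (unity_poly r)"
        by (simp add: mult.left_commute)
      moreover have "coprime N' (p ^ i)"
        using p N'(1) by (metis coprime_commute coprime_power_right_iff prime_imp_coprime)
      ultimately show ?thesis
        unfolding r_eq[symmetric] by (rule coprime_multiples_in_subring[OF M.comm_subring_axioms])
    qed
  qed
  moreover have "x \<in> T" unfolding T_def using x by (auto intro!: exI[of _ 1])
  ultimately show ?thesis unfolding r_eq[symmetric] by blast
qed

text \<open>The primes dividing the common denominator are stripped off one at a time. Each step
  takes place in A[z], which contains all integer multiples of \<open>x\<close>.\<close>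

lemma frobenius_stable_subset_integral_mod:
  assumes r: "r > 0"
    and A: "comm_subring A" "\<And>h. unity_poly r * h \<in> A"
    and frob: "\<And>p. Factorial_Ring.prime p \<Longrightarrow> frobenius_stable p A"
    and N: "N > 0" and bounded: "\<And>x. x \<in> A \<Longrightarrow> of_nat N * x \<in> integral_mod (unity_poly r)"
  shows "A \<subseteq> integral_mod (unity_poly r)"
proof
  interpret C: comm_subring "compositum A" using A(1) by (rule comm_subring_compositum)
  have sat: "x \<in> integral_mod (unity_poly r)"
    if "n > 0" "x \<in> compositum A" "of_nat n * x \<in> integral_mod (unity_poly r)" for n x
    using that
  proof (induction n rule: less_induct)
    case (less n)
    show ?case
    proof (cases "n = 1")
      case False
      then obtain p n' where p: "Factorial_Ring.prime p" "n = p * n'"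
        using prime_factor_nat by (metis dvdE)
      have n': "n' < n" "n' > 0" using p less.prems(1) prime_gt_1_nat[of p] by auto
      have "of_nat p * (of_nat n' * x) \<in> integral_mod (unity_poly r)"
        using less.prems(3) by (simp add: p(2) mult.assoc)
      then have "of_nat n' * x \<in> integral_mod (unity_poly r)"
        using C.mult_mem[OF C.of_nat_mem less.prems(2)] bounded
        by (intro p_saturated_compositum[OF p(1) r A frob[OF p(1)] N, of "of_nat n' * x"])
      then show ?thesis using less.IH n' less.prems(2) by blast
    qed (use less.prems in simp)
  qed
  fix x assume "x \<in> A"
  then show "x \<in> integral_mod (unity_poly r)"
    using sat[OF N] bounded subset_compositum by blast
qed

section \<open>Subrings of the quotient by \<open>z\<^sup>r - 1\<close>\<close>

lemma mu_class_eq_iff: "mu_class r f = mu_class r g \<longleftrightarrow> unity_poly r dvd f - g"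
proof
  assume "mu_class r f = mu_class r g"
  then show "unity_poly r dvd f - g" using self_in_mu_class[of f r] by (simp add: mu_class_eq)
qed (rule mu_class_cong)

lemma ideal_mu_ideal: "ideal (mu_ideal r :: 'a::comm_ring_1 poly set) poly_ring_of"
  unfolding mu_ideal_def
  by (rule cring.cgenideal_ideal[OF cring_from_type_algebra]) (simp add: ring_of_type_algebra_def)

lemma mu_ring_mult: "mu_class r f \<otimes>\<^bsub>mu_ring r\<^esub> mu_class r g = mu_class r (f * g)"
  using ideal.rcoset_mult_add[OF ideal_mu_ideal, of f g r]
  by (simp add: mu_ring_def FactRing_def mu_class_def ring_of_type_algebra_def)

lemma mu_ring_add: "mu_class r f \<oplus>\<^bsub>mu_ring r\<^esub> mu_class r g = mu_class r (f + g)"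
  using ideal.a_rcos_sum[OF ideal_mu_ideal, of f g r]
  by (simp add: mu_ring_def FactRing_def mu_class_def ring_of_type_algebra_def)

lemma mu_ring_one: "\<one>\<^bsub>mu_ring r\<^esub> = mu_class r 1"
  by (simp add: mu_ring_def FactRing_def mu_class_def ring_of_type_algebra_def)

lemma mu_ring_zero: "\<zero>\<^bsub>mu_ring r\<^esub> = mu_class r 0"
  by (simp add: mu_ring_def FactRing_def mu_class_eq mu_ideal_eq)

text \<open>Only the record fields of the ring structure are prescribed, so the same rules for
  classes serve Z[z]/(z^r - 1), the algebra Q[z]/(z^r - 1) and its restriction to the image of a
  subring.\<close>

locale mu_subring = comm_subring S for S :: "'a::comm_ring_1 poly set" +
  fixes L :: "('a poly set, 'm) ring_scheme" and r :: nat
  assumes carrier_eq: "carrier L = mu_class r ` S"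
    and mult_eq: "monoid.mult L = monoid.mult (mu_ring r)"
    and one_eq: "monoid.one L = monoid.one (mu_ring r)"
    and add_eq: "ring.add L = ring.add (mu_ring r)"
    and zero_eq: "ring.zero L = ring.zero (mu_ring r)"
begin

lemma ops:
  "mu_class r f \<otimes>\<^bsub>L\<^esub> mu_class r g = mu_class r (f * g)"
  "mu_class r f \<oplus>\<^bsub>L\<^esub> mu_class r g = mu_class r (f + g)"
  "\<one>\<^bsub>L\<^esub> = mu_class r 1"
  "\<zero>\<^bsub>L\<^esub> = mu_class r 0"
  by (simp_all add: mult_eq one_eq add_eq zero_eq mu_ring_mult mu_ring_add mu_ring_one mu_ring_zero)

lemma cring_L: "cring L"
proof (rule cringI)
  show "abelian_group L"
  proof (rule abelian_groupI)
    fix x assume "x \<in> carrier L"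
    then obtain f where "x = mu_class r f" "f \<in> S" by (auto simp: carrier_eq)
    then show "\<exists>y\<in>carrier L. y \<oplus>\<^bsub>L\<^esub> x = \<zero>\<^bsub>L\<^esub>"
      by (intro bexI[of _ "mu_class r (- f)"]) (auto simp: ops carrier_eq uminus_mem)
  qed (auto simp: ops carrier_eq add_mem zero_mem algebra_simps)
  show "Group.comm_monoid L"
    by (rule comm_monoidI) (auto simp: ops carrier_eq mems algebra_simps)
qed (auto simp: ops carrier_eq algebra_simps)

sublocale L: cring L by (rule cring_L)

lemma class_mem: "f \<in> S \<Longrightarrow> mu_class r f \<in> carrier L"
  by (simp add: carrier_eq)

lemma a_inv_class: "f \<in> S \<Longrightarrow> \<ominus>\<^bsub>L\<^esub> mu_class r f = mu_class r (- f)"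
  by (rule L.minus_equality) (auto simp: ops class_mem uminus_mem)

lemma a_minus_class: "\<lbrakk>f \<in> S; g \<in> S\<rbrakk> \<Longrightarrow> mu_class r f \<ominus>\<^bsub>L\<^esub> mu_class r g = mu_class r (f - g)"
  by (simp add: a_minus_def a_inv_class ops)

lemma pow_class: "mu_class r f [^]\<^bsub>L\<^esub> (n :: nat) = mu_class r (f ^ n)"
  by (induction n) (simp_all add: ops mult.commute)

lemma add_pow_class: "[n] \<cdot>\<^bsub>L\<^esub> mu_class r f = mu_class r (of_nat n * f)" for n :: nat
  by (induction n) (simp_all add: ops add_pow_def nat_pow_def algebra_simps)

lemma add_pow_int_class:
  fixes k :: int
  assumes "f \<in> S"
  shows "[k] \<cdot>\<^bsub>L\<^esub> mu_class r f = mu_class r (of_int k * f)"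
proof (cases "k \<ge> 0")
  case True
  then show ?thesis by (simp add: add_pow_int_ge add_pow_class)
next
  case False
  then have "[k] \<cdot>\<^bsub>L\<^esub> mu_class r f = \<ominus>\<^bsub>L\<^esub> mu_class r (of_nat (nat (- k)) * f)"
    by (simp add: add_pow_int_lt add_pow_class)
  also have "\<dots> = mu_class r (- (of_nat (nat (- k)) * f))"
    by (intro a_inv_class mult_mem of_nat_mem assms)
  finally show ?thesis using False by simp
qed

lemma finsum_class:
  assumes "finite I" "\<And>i. i \<in> I \<Longrightarrow> f i \<in> S"
  shows "finsum L (\<lambda>i. mu_class r (f i)) I = mu_class r (sum f I)"
  using assms
proof (induction I rule: finite_induct)
  case (insert i I)
  then show ?case by (simp add: L.finsum_insert class_mem Pi_def ops)
qed (simp add: ops)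

text \<open>Reduces the axioms to statements about representing polynomials, where
  \<open>mu_psi r p\<close> is the substitution z -> z^p.\<close>

lemma lambda_ring_mu_psi:
  assumes torsion_free: "\<And>n f. \<lbrakk>n > 0; unity_poly r dvd of_nat n * f\<rbrakk> \<Longrightarrow> unity_poly r dvd (f :: 'a poly)"
    and closed: "\<And>p f. f \<in> S \<Longrightarrow> substX p f \<in> S"
    and frob: "\<And>p f. \<lbrakk>Factorial_Ring.prime p; f \<in> S\<rbrakk> \<Longrightarrow> \<exists>g\<in>S. substX p f - f ^ p = of_nat p * g"
  shows "lambda_ring L (mu_psi r)"
proof
  fix x and n :: nat assume x: "x \<in> carrier L" "n > 0" "[n] \<cdot>\<^bsub>L\<^esub> x = \<zero>\<^bsub>L\<^esub>"
  obtain f where f: "x = mu_class r f" using x(1) by (auto simp: carrier_eq)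
  have "unity_poly r dvd of_nat n * f" using x(3) by (simp add: f add_pow_class ops mu_class_eq_iff)
  from torsion_free[OF x(2) this] show "x = \<zero>\<^bsub>L\<^esub>" by (simp add: f ops mu_class_eq_iff)
next
  fix p
  show "mu_psi r p \<in> ring_hom L L"
    by (rule ring_hom_memI)
      (auto simp: carrier_eq ops mu_psi_class closed pcompose_mult pcompose_add pcompose_1)
next
  fix p q x assume "x \<in> carrier L"
  then show "mu_psi r p (mu_psi r q x) = mu_psi r q (mu_psi r p x)"
    by (auto simp: carrier_eq mu_psi_class substX_substX mult.commute)
next
  fix p :: nat and x assume p: "Factorial_Ring.prime p" and "x \<in> carrier L"
  then obtain f where f: "x = mu_class r f" "f \<in> S" by (auto simp: carrier_eq)
  obtain g where "g \<in> S" "substX p f - f ^ p = of_nat p * g" using frob[OF p f(2)] by blast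
  then show "\<exists>y\<in>carrier L. mu_psi r p x \<ominus>\<^bsub>L\<^esub> x [^]\<^bsub>L\<^esub> p = [p] \<cdot>\<^bsub>L\<^esub> y"
    by (intro bexI[of _ "mu_class r g"])
      (auto simp: f mu_psi_class pow_class a_minus_class closed power_mem add_pow_class class_mem)
qed

end

section \<open>The Lambda-rings Z[z]/(z^r - 1) and Q[z]/(z^r - 1)\<close>

lemma mu_subring_mu_ring: "mu_subring UNIV (mu_ring r) r"
  by unfold_locales (auto simp: carrier_mu_ring)

lemma mu_subring_rat_algebra: "mu_subring UNIV (mu_rat_algebra r) r"
  by unfold_locales (auto simp: carrier_mu_ring mu_rat_algebra_def)

lemma mu_subring_carrier_update:
  assumes "comm_subring S"
  shows "mu_subring S (mu_rat_algebra r\<lparr>carrier := mu_class r ` S\<rparr>) r"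
proof -
  interpret comm_subring S by fact
  show ?thesis by unfold_locales (auto simp: mu_rat_algebra_def)
qed

lemma rat_poly_torsion_free:
  fixes f :: "rat poly"
  assumes "n > 0" "P dvd of_nat n * f"
  shows "P dvd f"
  using assms by (simp add: of_nat_poly dvd_smult_iff)

lemma map_poly_of_int_hom:
  "map_poly rat_of_int (f + g) = map_poly rat_of_int f + map_poly rat_of_int g"
  "map_poly rat_of_int (f - g) = map_poly rat_of_int f - map_poly rat_of_int g"
  "map_poly rat_of_int (f * g) = map_poly rat_of_int f * map_poly rat_of_int g"
  "map_poly rat_of_int (Polynomial.monom 1 k) = Polynomial.monom 1 k"
  "map_poly rat_of_int 1 = 1"
  "map_poly rat_of_int (of_nat n) = of_nat n"
  "map_poly rat_of_int f = map_poly rat_of_int g \<longleftrightarrow> f = g"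
  by (auto intro!: poly_eqI simp: coeff_map_poly coeff_mult of_nat_poly coeff_pCons poly_eq_iff
      split: nat.splits)

text \<open>The rational cofactor is integral because z^r - 1 is monic. This gives injectivity of
  \<open>mu_incl\<close> and torsion-freeness over the integers.\<close>

lemma unity_poly_dvd_int_iff:
  assumes "r > 0"
  shows "unity_poly r dvd (f :: int poly) \<longleftrightarrow> unity_poly r dvd map_poly rat_of_int f"
proof
  assume "unity_poly r dvd map_poly rat_of_int f"
  then obtain h where h: "map_poly rat_of_int f = unity_poly r * h" by (elim dvdE)
  have "unity_poly r * h \<in> int_polys" unfolding h[symmetric] by (auto simp: int_polys_eq_range)
  then have "h \<in> int_polys"
    using int_polys_cancel_monic[OF _ unity_poly_int_polys monic_unity_poly[OF assms]] by blast
  then obtain k where "h = map_poly rat_of_int k" by (auto simp: int_polys_eq_range)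
  with h have "map_poly rat_of_int f = map_poly rat_of_int (unity_poly r * k)"
    by (simp add: map_poly_of_int_hom)
  then have "f = unity_poly r * k" by (simp only: map_poly_of_int_hom(7))
  then show "unity_poly r dvd f" by simp
next
  assume "unity_poly r dvd f"
  then obtain k where "f = unity_poly r * k" by (elim dvdE)
  then show "unity_poly r dvd map_poly rat_of_int f" by (simp add: map_poly_of_int_hom)
qed

lemma lambda_ring_mu_int:
  assumes "r > 0"
  shows "lambda_ring (mu_ring r :: int poly set ring) (mu_psi r)"
proof (rule mu_subring.lambda_ring_mu_psi[OF mu_subring_mu_ring])
  fix n :: nat and f :: "int poly"
  assume n: "n > 0" "unity_poly r dvd of_nat n * f"
  then have "unity_poly r dvd of_nat n * map_poly rat_of_int f"
    by (simp add: unity_poly_dvd_int_iff[OF assms] map_poly_of_int_hom)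
  from rat_poly_torsion_free[OF n(1) this] show "unity_poly r dvd f"
    by (simp add: unity_poly_dvd_int_iff[OF assms])
next
  fix p :: nat and f :: "int poly" assume "Factorial_Ring.prime p"
  then show "\<exists>g\<in>UNIV. substX p f - f ^ p = of_nat p * g" using substX_prime_int_poly by blast
qed simp

lemma lambda_ring_mu_rat: "lambda_ring (mu_rat_algebra r) (mu_psi r)"
proof (rule mu_subring.lambda_ring_mu_psi[OF mu_subring_rat_algebra])
  fix p :: nat and f :: "rat poly"
  assume "Factorial_Ring.prime p"
  then have "substX p f - f ^ p = of_nat p * smult (1 / of_nat p) (substX p f - f ^ p)"
    by (simp add: of_nat_poly prime_gt_0_nat)
  then show "\<exists>g\<in>UNIV. substX p f - f ^ p = of_nat p * g" by blast
next
  fix n :: nat and f :: "rat poly" assume "n > 0" "unity_poly r dvd of_nat n * f"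
  then show "unity_poly r dvd f" by (rule rat_poly_torsion_free)
qed simp

lemma mu_incl_image: "mu_incl r ` carrier (mu_ring r) = mu_class r ` int_polys"
  by (simp add: carrier_mu_ring mu_incl_class int_polys_eq_range image_image)

lemma lambda_embedding_mu_incl:
  assumes "r > 0"
  shows "lambda_embedding (mu_ring r) (mu_psi r) (mu_rat_algebra r) (mu_psi r) (mu_incl r)"
proof -
  interpret R: mu_subring UNIV "mu_ring r :: int poly set ring" r by (rule mu_subring_mu_ring)
  interpret K: mu_subring UNIV "mu_rat_algebra r" r by (rule mu_subring_rat_algebra)
  have hom: "mu_incl r \<in> ring_hom (mu_ring r) (mu_rat_algebra r)"
    by (rule ring_hom_memI) (auto simp: R.carrier_eq K.carrier_eq R.ops K.ops mu_incl_class map_poly_of_int_hom)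
  have inj: "inj_on (mu_incl r) (carrier (mu_ring r))"
  proof (rule inj_onI)
    fix x y assume "x \<in> carrier (mu_ring r)" "y \<in> carrier (mu_ring r)" and eq: "mu_incl r x = mu_incl r y"
    then obtain f g where fg: "x = mu_class r f" "y = mu_class r g" by (auto simp: R.carrier_eq)
    show "x = y"
      using eq by (simp add: fg mu_incl_class mu_class_eq_iff unity_poly_dvd_int_iff[OF assms] map_poly_of_int_hom)
  qed
  have "map_poly rat_of_int (substX p f) = substX p (map_poly rat_of_int f)" for p f
    by (induction f) (simp_all add: pcompose_pCons map_poly_pCons map_poly_of_int_hom)
  then show ?thesis
    unfolding lambda_embedding_def using hom inj by (auto simp: R.carrier_eq mu_incl_class mu_psi_class)
qed

lemma smult_rat_algebra: "q \<odot>\<^bsub>mu_rat_algebra r\<^esub> mu_class r f = mu_class r (smult q f)"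
  by (simp add: mu_rat_algebra_def mu_ring_mult)

lemma algebra_mu_rat: "algebra rat_ring (mu_rat_algebra r)"
proof -
  interpret K: mu_subring UNIV "mu_rat_algebra r" r by (rule mu_subring_rat_algebra)
  show ?thesis
    by (rule algebraI[OF cring_from_type_algebra K.cring_L])
      (auto simp: K.carrier_eq smult_rat_algebra K.ops ring_of_type_algebra_def smult_add_left smult_add_right)
qed

lemma sub_lambda_ring_int:
  "sub_lambda_ring (mu_class r ` int_polys) (mu_rat_algebra r) (mu_psi r)"
proof -
  interpret K: mu_subring UNIV "mu_rat_algebra r" r by (rule mu_subring_rat_algebra)
  have "subring (mu_class r ` int_polys) (mu_rat_algebra r)"
    by (rule K.L.subringI) (auto simp: K.carrier_eq K.ops K.a_inv_class Z.mems)
  moreover have "lambda_ring (mu_rat_algebra r\<lparr>carrier := mu_class r ` int_polys\<rparr>) (mu_psi r)"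
    by (rule mu_subring.lambda_ring_mu_psi[OF mu_subring_carrier_update[OF Z.comm_subring_axioms]])
      (erule (1) rat_poly_torsion_free | erule pcompose_monom_int_polys | erule (1) substX_prime_int_polys)+
  ultimately show ?thesis
    unfolding sub_lambda_ring_def
    using lambda_ring_mu_rat by (auto simp: mu_psi_class pcompose_monom_int_polys)
qed

lemma finitely_generated_int:
  assumes "r > 0"
  shows "\<exists>S. finite S \<and> S \<subseteq> mu_class r ` int_polys \<and>
    generate (add_monoid (mu_rat_algebra r)) S = mu_class r ` int_polys"
proof -
  interpret K: mu_subring UNIV "mu_rat_algebra r" r by (rule mu_subring_rat_algebra)
  let ?G = "add_monoid (mu_rat_algebra r)"
  define S where "S = (\<lambda>k. mu_class r (Polynomial.monom (1::rat) k)) ` {..<r}"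
  have S: "S \<subseteq> mu_class r ` int_polys" using monom_int_polys by (auto simp: S_def)
  note G = K.L.a_group
  have sub: "subgroup (mu_class r ` int_polys) ?G"
    using sub_lambda_ring_int by (auto simp: sub_lambda_ring_def subring_def)
  have gen: "subgroup (generate ?G S) ?G"
    using S by (intro group.generate_is_subgroup[OF G]) (auto simp: K.carrier_eq)
  have add: "mu_class r (f + g) \<in> generate ?G S"
    if "mu_class r f \<in> generate ?G S" "mu_class r g \<in> generate ?G S" for f g
    using generate.eng[OF that] by (simp add: K.ops)
  have X: "mu_class r (Polynomial.monom 1 k) \<in> generate ?G S" for k
  proof -
    \<comment> \<open>Exponents may be reduced modulo \<open>r\<close>, so 1, z, ..., z^(r-1)
      suffice as generators.\<close>
    have "(Polynomial.monom 1 k :: rat poly) - Polynomial.monom 1 (k mod r) =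
        Polynomial.monom 1 (k mod r) * unity_poly (r * (k div r))"
      by (simp add: right_diff_distrib mult_monom)
    then have "mu_class r (Polynomial.monom (1::rat) k) = mu_class r (Polynomial.monom 1 (k mod r))"
      unfolding mu_class_eq_iff unity_poly_mult by (metis dvd_triv_left dvd_mult)
    then show ?thesis using assms by (auto simp: S_def intro!: generate.incl)
  qed
  \<comment> \<open>The shift \<open>k\<close> is generalised so that the Horner step z^k (c + z f)
    = c z^k + z^(k+1) f closes the induction.\<close>
  have "mu_class r (Polynomial.monom 1 k * f) \<in> generate ?G S" if "f \<in> int_polys" for f k
    using that
  proof (induction f arbitrary: k)
    case 0
    show ?case using generate.one[of ?G S] by (simp add: K.ops)
  next
    case (pCons a f)
    then obtain c where c: "a = of_int c" and f: "f \<in> int_polys"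
      by (auto simp: int_polys_pCons_iff elim: Ints_cases)
    have eq: "Polynomial.monom 1 k * pCons a f = of_int c * Polynomial.monom 1 k + Polynomial.monom 1 (Suc k) * f"
      by (simp add: c of_int_poly monom_Suc)
    have "[c] \<cdot>\<^bsub>mu_rat_algebra r\<^esub> mu_class r (Polynomial.monom 1 k) \<in> generate ?G S"
      using group.subgroup_int_pow_closed[OF G gen X] by (simp add: add_pow_def)
    then have "mu_class r (of_int c * Polynomial.monom 1 k) \<in> generate ?G S"
      by (simp add: K.add_pow_int_class)
    then show ?case unfolding eq using pCons.IH[OF f] by (rule add)
  qed
  from this[of _ 0] have "mu_class r ` int_polys \<subseteq> generate ?G S" by (auto simp: monom_0)
  moreover have "generate ?G S \<subseteq> mu_class r ` int_polys" by (rule group.generate_subgroup_incl[OF G S sub])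
  ultimately show ?thesis using S by (intro exI[of _ S]) (auto simp: S_def)
qed

section \<open>Extension of scalars to the rationals\<close>

lemma rat_poly_common_denominator:
  fixes f :: "rat poly"
  shows "\<exists>n>0. of_nat n * f \<in> int_polys"
proof (induction f)
  case 0
  then show ?case by (intro exI[of _ 1]) (simp add: Z.zero_mem)
next
  case (pCons a f)
  then obtain n where n: "n > 0" "of_nat n * f \<in> int_polys" by blast
  obtain u v where uv: "a = of_int u / of_int v" "v > 0"
    by (metis quotient_of_div quotient_of_denom_pos surj_pair)
  have "of_nat (nat v) * a = of_int u" using uv by (simp add: of_nat_nat)
  then have "of_nat (n * nat v) * a = of_int (int n * u)" by (simp add: mult.assoc)
  then have "of_nat (n * nat v) * a \<in> \<int>" by (metis Ints_of_int)
  moreover have "of_nat (nat v) * (of_nat n * f) \<in> int_polys" by (intro Z.mult_mem Z.of_nat_mem n(2))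
  then have "of_nat (n * nat v) * f \<in> int_polys" by (simp add: mult_ac)
  moreover have "of_nat (n * nat v) * pCons a f =
      pCons (of_nat (n * nat v) * a) (of_nat (n * nat v) * f)"
    by (simp only: of_nat_poly) simp
  ultimately have "of_nat (n * nat v) * pCons a f \<in> int_polys"
    by (simp only: int_polys_pCons_iff)
  then show ?case using n(1) uv(2) by (intro exI[of _ "n * nat v"]) simp
qed

text \<open>The generator standing for the tensor of \<open>q\<close> with the class of
  \<open>f\<close>, indexed by a polynomial so that calculations happen in Q[z].\<close>

definition simple_tensor :: "nat \<Rightarrow> rat \<Rightarrow> rat poly \<Rightarrow> (rat \<times> rat poly set) \<Rightarrow>\<^sub>0 int" where
  "simple_tensor r q f = frag_of (q, mu_class r f)"

locale mu_tensor =
  fixes r :: nat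
begin

abbreviation A where "A \<equiv> mu_class r ` int_polys"
abbreviation K where "K \<equiv> mu_rat_algebra r"
abbreviation "relations \<equiv> tensor_relations (add_monoid rat_ring) (add_monoid (K\<lparr>carrier := A\<rparr>))"
abbreviation "F \<equiv> free_Abelian_group (UNIV \<times> A)"
abbreviation "G \<equiv> generate F relations"

sublocale K: mu_subring UNIV K r by (rule mu_subring_rat_algebra)

lemma relations_eq:
  "relations =
     {simple_tensor r (q + q') f - simple_tensor r q f - simple_tensor r q' f | q q' f. f \<in> int_polys} \<union>
     {simple_tensor r q (f + f') - simple_tensor r q f - simple_tensor r q f' | q f f'.
        f \<in> int_polys \<and> f' \<in> int_polys}"
proof -
  have "relations =
     {frag_of (q + q', a) - frag_of (q, a) - frag_of (q', a) | q q' a. a \<in> A} \<union>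
     {frag_of (q, a \<oplus>\<^bsub>K\<^esub> a') - frag_of (q, a) - frag_of (q, a') | q a a'. a \<in> A \<and> a' \<in> A}"
    by (simp add: tensor_relations_def ring_of_type_algebra_def)
  moreover have "{frag_of (q + q' :: rat, a) - frag_of (q, a) - frag_of (q', a) | q q' a. a \<in> A} =
     {frag_of (q + q', mu_class r f) - frag_of (q, mu_class r f) - frag_of (q', mu_class r f) | q q' f.
        f \<in> int_polys}"
    by blast
  moreover have "{frag_of (q :: rat, a \<oplus>\<^bsub>K\<^esub> a') - frag_of (q, a) - frag_of (q, a') | q a a'. a \<in> A \<and> a' \<in> A} =
     {frag_of (q, mu_class r f \<oplus>\<^bsub>K\<^esub> mu_class r f') - frag_of (q, mu_class r f) - frag_of (q, mu_class r f') |
        q f f'. f \<in> int_polys \<and> f' \<in> int_polys}"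
    by blast
  ultimately show ?thesis by (simp only: simple_tensor_def K.ops)
qed

section \<open>The scaling map as a homomorphism on the free abelian group\<close>

definition rep :: "rat poly set \<Rightarrow> rat poly" where
  "rep a = (SOME f. f \<in> int_polys \<and> mu_class r f = a)"

lemma rep: "a \<in> A \<Longrightarrow> rep a \<in> int_polys \<and> mu_class r (rep a) = a"
  unfolding rep_def by (rule someI_ex) blast

text \<open>A lift of \<open>scaling_sum\<close> to Q[z]. One representative is fixed for each
  class, which makes the lift additive.\<close>

definition lift :: "(rat \<times> rat poly set \<Rightarrow>\<^sub>0 int) \<Rightarrow> rat poly" where
  "lift c = (\<Sum>k\<in>Poly_Mapping.keys c. of_int (Poly_Mapping.lookup c k) * smult (fst k) (rep (snd k)))"

lemma lift_superset:
  assumes "finite I" "Poly_Mapping.keys c \<subseteq> I"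
  shows "lift c = (\<Sum>k\<in>I. of_int (Poly_Mapping.lookup c k) * smult (fst k) (rep (snd k)))"
  unfolding lift_def using assms
  by (intro sum.mono_neutral_left) (auto simp: in_keys_iff)

lemma lift_add: "lift (c + d) = lift c + lift d"
proof -
  let ?I = "Poly_Mapping.keys c \<union> Poly_Mapping.keys d"
  have "Poly_Mapping.keys (c + d) \<subseteq> ?I" by (rule keys_add)
  then show ?thesis
    by (simp add: lift_superset[of ?I] lookup_add sum.distrib[symmetric] distrib_right smult_add_right)
qed

lemma scaling_sum_eq:
  assumes "Poly_Mapping.keys c \<subseteq> UNIV \<times> A"
  shows "scaling_sum K c = mu_class r (lift c)"
proof -
  have "scaling_sum K c = finsum K (\<lambda>k. mu_class r
      (of_int (Poly_Mapping.lookup c k) * smult (fst k) (rep (snd k)))) (Poly_Mapping.keys c)"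
    unfolding scaling_sum_def
  proof (rule K.L.finsum_cong')
    fix k assume "k \<in> Poly_Mapping.keys c"
    then have "snd k \<in> A" using assms by auto
    then have s: "snd k = mu_class r (rep (snd k))" by (simp add: rep)
    show "(case k of (q, a) \<Rightarrow> [Poly_Mapping.lookup c (q, a)] \<cdot>\<^bsub>K\<^esub> (q \<odot>\<^bsub>K\<^esub> a)) =
        mu_class r (of_int (Poly_Mapping.lookup c k) * smult (fst k) (rep (snd k)))"
      unfolding case_prod_beta prod.collapse
      by (subst s) (simp only: smult_rat_algebra K.add_pow_int_class[OF UNIV_I])
  qed (auto intro: K.class_mem)
  then show ?thesis by (simp add: K.finsum_class lift_def)
qed

lemma scaling_sum_simple_tensor:
  assumes "f \<in> int_polys"
  shows "scaling_sum K (simple_tensor r q f) = mu_class r (smult q f)"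
proof -
  have "lift (simple_tensor r q f) = smult q (rep (mu_class r f))"
    by (simp add: lift_def simple_tensor_def)
  moreover have "mu_class r (smult q (rep (mu_class r f))) = mu_class r (smult q f)"
  proof -
    have "mu_class r (rep (mu_class r f)) = mu_class r f" using rep assms by blast
    then show ?thesis by (simp flip: smult_rat_algebra)
  qed
  ultimately show ?thesis
    using assms by (subst scaling_sum_eq) (auto simp: simple_tensor_def)
qed

lemma group_hom_scaling: "group_hom F (add_monoid K) (scaling_sum K)"
proof -
  have "scaling_sum K (c + d) = scaling_sum K c \<oplus>\<^bsub>K\<^esub> scaling_sum K d"
    if "Poly_Mapping.keys c \<subseteq> UNIV \<times> A" "Poly_Mapping.keys d \<subseteq> UNIV \<times> A" for c d
  proof -
    have "Poly_Mapping.keys (c + d) \<subseteq> UNIV \<times> A" using keys_add[of c d] that by blast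
    then show ?thesis using that by (simp add: scaling_sum_eq lift_add K.ops)
  qed
  then have "scaling_sum K \<in> hom F (add_monoid K)"
    by (intro homI) (auto simp: scaling_sum_eq K.carrier_eq)
  then show ?thesis
    by (simp add: group_hom_def group_hom_axioms_def K.L.a_group)
qed

sublocale scaling: group_hom F "add_monoid K" "scaling_sum K" by (rule group_hom_scaling)

section \<open>Normal form of tensors and the kernel of the scaling map\<close>

lemma simple_tensor_mem: "f \<in> int_polys \<Longrightarrow> simple_tensor r q f \<in> carrier F"
  by (simp add: simple_tensor_def)

lemma keys_diff_mem: "\<lbrakk>x \<in> carrier F; y \<in> carrier F\<rbrakk> \<Longrightarrow> x - y \<in> carrier F"
  using keys_diff[of x y] by auto

lemma relations_subset: "relations \<subseteq> carrier F"
  unfolding relations_eq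
  by (auto simp del: carrier_free_Abelian_group_iff intro!: keys_diff_mem simple_tensor_mem Z.add_mem)

lemma subgroup_G: "subgroup G F"
  by (rule group.generate_is_subgroup[OF group_free_Abelian_group relations_subset])

lemma G_add: "\<lbrakk>x \<in> G; y \<in> G\<rbrakk> \<Longrightarrow> x + y \<in> G"
  using subgroup.m_closed[OF subgroup_G] by simp

lemma G_uminus: "x \<in> G \<Longrightarrow> - x \<in> G"
  using subgroup.m_inv_closed[OF subgroup_G, of x] subgroup.mem_carrier[OF subgroup_G, of x] by simp

lemma G_diff: "\<lbrakk>x \<in> G; y \<in> G\<rbrakk> \<Longrightarrow> x - y \<in> G"
  using G_add[OF _ G_uminus] by fastforce

lemma G_left: "f \<in> int_polys \<Longrightarrow>
    simple_tensor r (q + q') f - simple_tensor r q f - simple_tensor r q' f \<in> G"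
  by (rule generate.incl) (unfold relations_eq, blast)

lemma G_right: "\<lbrakk>f \<in> int_polys; f' \<in> int_polys\<rbrakk> \<Longrightarrow>
    simple_tensor r q (f + f') - simple_tensor r q f - simple_tensor r q f' \<in> G"
  by (rule generate.incl) (unfold relations_eq, blast)

text \<open>Additivity modulo \<open>G\<close> forces linearity modulo \<open>G\<close>; this is
  used in either slot of the tensor.\<close>

lemma G_multiple:
  fixes h :: "int \<Rightarrow> (rat \<times> rat poly set \<Rightarrow>\<^sub>0 int)"
  assumes "\<And>k l. h (k + l) - h k - h l \<in> G"
  shows "h k - frag_cmul k (h 1) \<in> G"
proof (induction k rule: int_induct[where k = 0])
  case base
  have "- (h (0 + 0) - h 0 - h 0) \<in> G" by (rule G_uminus) (rule assms)
  then show ?case by simp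
next
  case (step1 i)
  have "(h (i + 1) - h i - h 1) + (h i - frag_cmul i (h 1)) \<in> G" by (rule G_add[OF assms step1(2)])
  then show ?case by (simp add: frag_cmul_distrib algebra_simps)
next
  case (step2 i)
  have "(h i - frag_cmul i (h 1)) - (h (i - 1 + 1) - h (i - 1) - h 1) \<in> G"
    by (rule G_diff[OF step2(2) assms])
  moreover have "frag_cmul i (h 1) = frag_cmul (i - 1) (h 1) + h 1"
    using frag_cmul_distrib[of "i - 1" 1 "h 1"] by simp
  ultimately show ?case by (simp add: algebra_simps)
qed

text \<open>Both tensors agree modulo \<open>G\<close> with \<open>k\<close> times the tensor of
  \<open>q\<close> and \<open>f\<close>.\<close>

lemma G_move:
  assumes f: "f \<in> int_polys"
  shows "simple_tensor r (of_int k * q) f - simple_tensor r q (of_int k * f) \<in> G"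
proof -
  have "simple_tensor r (of_int k * q) f - frag_cmul k (simple_tensor r (of_int 1 * q) f) \<in> G"
    by (rule G_multiple) (simp only: of_int_add distrib_right G_left[OF f])
  moreover have "simple_tensor r q (of_int k * f) - frag_cmul k (simple_tensor r q (of_int 1 * f)) \<in> G"
    by (rule G_multiple) (simp only: of_int_add distrib_right, intro G_right Z.mult_mem Z.of_int_mem f)
  ultimately have "(simple_tensor r (of_int k * q) f - frag_cmul k (simple_tensor r (of_int 1 * q) f)) -
      (simple_tensor r q (of_int k * f) - frag_cmul k (simple_tensor r q (of_int 1 * f))) \<in> G"
    by (rule G_diff)
  then show ?thesis by simp
qed

text \<open>Any sum of tensors can be brought to a common denominator \<open>n\<close>, and integers
  move into the right-hand factor.\<close>

lemma G_normal_form: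
  assumes "c \<in> carrier F"
  shows "\<exists>n>0. \<exists>f\<in>int_polys. c - simple_tensor r (1 / of_nat n) f \<in> G"
  using assms unfolding carrier_free_Abelian_group_iff
proof (induction c rule: free_Abelian_group_induct[consumes 1, case_names zero diff gen])
  case zero
  have "simple_tensor r 1 (0 + 0) - simple_tensor r 1 0 - simple_tensor r 1 0 \<in> G"
    by (rule G_right) (rule Z.zero_mem)+
  then show ?case by (intro exI[of _ 1] conjI bexI[of _ 0]) (auto simp: Z.zero_mem)
next
  case (diff c d)
  then obtain n f m g where n: "n > 0" "f \<in> int_polys" "c - simple_tensor r (1 / of_nat n) f \<in> G"
    and m: "m > 0" "g \<in> int_polys" "d - simple_tensor r (1 / of_nat m) g \<in> G"
    by blast
  \<comment> \<open>Over the common denominator \<open>n * m\<close>, the difference of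
    \<open>f / n\<close> and \<open>g / m\<close> has this numerator.\<close>
  define f' where "f' = of_int (int m) * f - of_int (int n) * g"
  define q where "q = 1 / rat_of_nat (n * m)"
  have mf: "of_int (int m) * f \<in> int_polys" "of_int (int n) * g \<in> int_polys"
    by (intro Z.mult_mem Z.of_int_mem n m)+
  have f': "f' \<in> int_polys" unfolding f'_def by (intro Z.diff_mem mf)
  have "rat_of_int (int m) * q = 1 / of_nat n" "rat_of_int (int n) * q = 1 / of_nat m"
    using n(1) m(1) by (auto simp: q_def)
  then have 1: "simple_tensor r (1 / of_nat n) f - simple_tensor r q (of_int (int m) * f) \<in> G"
    and 2: "simple_tensor r (1 / of_nat m) g - simple_tensor r q (of_int (int n) * g) \<in> G"
    using G_move[OF n(2), of "int m" q] G_move[OF m(2), of "int n" q] by metis+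
  have 3: "simple_tensor r q (f' + of_int (int n) * g) - simple_tensor r q f' -
      simple_tensor r q (of_int (int n) * g) \<in> G"
    by (rule G_right[OF f' mf(2)])
  have "(c - simple_tensor r (1 / of_nat n) f) - (d - simple_tensor r (1 / of_nat m) g) +
      (simple_tensor r (1 / of_nat n) f - simple_tensor r q (of_int (int m) * f)) -
      (simple_tensor r (1 / of_nat m) g - simple_tensor r q (of_int (int n) * g)) +
      (simple_tensor r q (f' + of_int (int n) * g) - simple_tensor r q f' -
      simple_tensor r q (of_int (int n) * g)) \<in> G"
    by (intro G_add G_diff n m 1 2 3)
  moreover have "f' + of_int (int n) * g = of_int (int m) * f" by (simp add: f'_def)
  ultimately have "c - d - simple_tensor r q f' \<in> G" by (simp add: algebra_simps)
  then show ?case using f' n(1) m(1) unfolding q_def by (intro exI[of _ "n * m"]) auto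
next
  case (gen a)
  then obtain q f where a: "a = (q, mu_class r f)" "f \<in> int_polys" by auto
  obtain u v where uv: "q = of_int u / of_int v" "v > 0"
    by (metis quotient_of_div quotient_of_denom_pos surj_pair)
  have "of_int u * (1 / rat_of_nat (nat v)) = q" using uv by simp
  then have "simple_tensor r q f - simple_tensor r (1 / of_nat (nat v)) (of_int u * f) \<in> G"
    using G_move[OF a(2), of u "1 / of_nat (nat v)"] by metis
  then show ?case
    using uv(2) a(2) unfolding a(1) simple_tensor_def[symmetric]
    by (intro exI[of _ "nat v"] conjI bexI[of _ "of_int u * f"] Z.mult_mem Z.of_int_mem) auto
qed

lemma relations_kernel: "relations \<subseteq> kernel F (add_monoid K) (scaling_sum K)"
proof -
  have hom_diff: "scaling_sum K (x - y) = scaling_sum K x \<ominus>\<^bsub>K\<^esub> scaling_sum K y"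
    if "x \<in> carrier F" "y \<in> carrier F" for x y
  proof -
    have "scaling_sum K ((x - y) + y) = scaling_sum K (x - y) \<oplus>\<^bsub>K\<^esub> scaling_sum K y"
      using scaling.hom_mult[OF keys_diff_mem[OF that] that(2)] by simp
    moreover have "scaling_sum K (x - y) \<in> carrier K" "scaling_sum K y \<in> carrier K"
      using scaling.hom_closed[OF keys_diff_mem[OF that]] scaling.hom_closed[OF that(2)] by simp_all
    ultimately show ?thesis by (simp add: a_minus_def K.L.a_assoc K.L.r_neg)
  qed
  have "x \<in> carrier F \<and> scaling_sum K x = \<zero>\<^bsub>K\<^esub>" if "x \<in> relations" for x
  proof -
    have "x \<in> carrier F" using that relations_subset by blast
    moreover have "scaling_sum K x = \<zero>\<^bsub>K\<^esub>"
      using that unfolding relations_eq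
      by (auto simp: hom_diff simple_tensor_mem keys_diff_mem scaling_sum_simple_tensor Z.add_mem
        K.a_minus_class K.ops smult_add_left smult_add_right simp del: carrier_free_Abelian_group_iff)
    ultimately show ?thesis by blast
  qed
  then show ?thesis by (auto simp: kernel_def)
qed

text \<open>A normal form with entries 1/n and \<open>f\<close> is killed only if z^r - 1 divides
  f/n, hence \<open>f\<close>. Then it is the tensor of 1/n with zero, which lies in
  \<open>G\<close>.\<close>

lemma kernel_eq: "kernel F (add_monoid K) (scaling_sum K) = G"
proof
  have G_kernel: "G \<subseteq> kernel F (add_monoid K) (scaling_sum K)"
    by (rule group.generate_subgroup_incl[OF group_free_Abelian_group relations_kernel scaling.subgroup_kernel])
  then show "G \<subseteq> kernel F (add_monoid K) (scaling_sum K)" .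
  show "kernel F (add_monoid K) (scaling_sum K) \<subseteq> G"
  proof
    fix c assume c: "c \<in> kernel F (add_monoid K) (scaling_sum K)"
    then have "c \<in> carrier F" by (simp add: kernel_def)
    then obtain n f where n: "n > 0" "f \<in> int_polys" "c - simple_tensor r (1 / of_nat n) f \<in> G"
      using G_normal_form by blast
    let ?t = "simple_tensor r (1 / of_nat n) f"
    have ker: "subgroup (kernel F (add_monoid K) (scaling_sum K)) F" by (rule scaling.subgroup_kernel)
    \<comment> \<open>Written additively, this element is \<open>- (c - ?t) + c\<close>, that is
      \<open>?t\<close>.\<close>
    have "inv\<^bsub>F\<^esub> (c - ?t) \<otimes>\<^bsub>F\<^esub> c \<in> kernel F (add_monoid K) (scaling_sum K)"
      using n(3) G_kernel c by (intro subgroup.m_closed[OF ker] subgroup.m_inv_closed[OF ker]) auto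
    moreover have "c - ?t \<in> carrier F" using n(3) subgroup.mem_carrier[OF subgroup_G] by blast
    ultimately have "?t \<in> kernel F (add_monoid K) (scaling_sum K)" by simp
    then have "mu_class r (smult (1 / of_nat n) f) = mu_class r 0"
      by (simp add: kernel_def scaling_sum_simple_tensor[OF n(2)] K.ops)
    then have "unity_poly r dvd f" using n(1) by (simp add: mu_class_eq_iff dvd_smult_iff)
    then have "mu_class r f = mu_class r 0" by (simp add: mu_class_eq_iff)
    then have t: "?t = simple_tensor r (1 / of_nat n) 0" by (simp add: simple_tensor_def)
    have "simple_tensor r (1 / of_nat n) (0 + 0) - simple_tensor r (1 / of_nat n) 0 -
        simple_tensor r (1 / of_nat n) 0 \<in> G"
      by (rule G_right) (rule Z.zero_mem)+
    then have "- ?t \<in> G" by (simp add: t)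
    then have "(c - ?t) - (- ?t) \<in> G" by (rule G_diff[OF n(3)])
    then show "c \<in> G" by simp
  qed
qed

text \<open>Common denominators give surjectivity; the first isomorphism theorem then applies, its
  induced map on cosets being \<open>scaling_map\<close>.\<close>

lemma rational_tensor_eq_int: "rational_tensor_eq A K"
proof -
  have "scaling_sum K ` carrier F = carrier (add_monoid K)"
  proof
    show "scaling_sum K ` carrier F \<subseteq> carrier (add_monoid K)" using scaling.hom_closed by blast
    show "carrier (add_monoid K) \<subseteq> scaling_sum K ` carrier F"
    proof
      fix x assume "x \<in> carrier (add_monoid K)"
      then obtain f where f: "x = mu_class r f" by (auto simp: K.carrier_eq)
      obtain n where n: "n > 0" "of_nat n * f \<in> int_polys" using rat_poly_common_denominator by blast
      have "x = scaling_sum K (simple_tensor r (1 / of_nat n) (of_nat n * f))"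
        using n by (simp add: scaling_sum_simple_tensor f) (simp add: of_nat_poly)
      then show "x \<in> scaling_sum K ` carrier F" using simple_tensor_mem[OF n(2)] by blast
    qed
  qed
  from scaling.FactGroup_iso_set[OF this] show ?thesis
    unfolding rational_tensor_eq_def tensor_Z_def kernel_eq
    by (simp add: scaling_map_def[abs_def] ring_of_type_algebra_def)
qed

end

section \<open>Maximality\<close>

lemma integral_lambda_model_int:
  assumes "r > 0"
  shows "integral_lambda_model (mu_class r ` int_polys) (mu_rat_algebra r) (mu_psi r)"
  unfolding integral_lambda_model_def
  by (intro conjI algebra_mu_rat sub_lambda_ring_int finitely_generated_int[OF assms]
      mu_tensor.rational_tensor_eq_int)

lemma mu_class_in_int_iff: "mu_class r f \<in> mu_class r ` int_polys \<longleftrightarrow> f \<in> integral_mod (unity_poly r)"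
proof
  assume "mu_class r f \<in> mu_class r ` int_polys"
  then obtain g k where g: "g \<in> int_polys" "f - g = unity_poly r * k"
    by (metis dvdE imageE mu_class_eq_iff)
  show "f \<in> integral_mod (unity_poly r)"
    using g(2) by (intro integral_modI[OF _ g(1), of _ _ k]) (simp add: algebra_simps)
next
  assume "f \<in> integral_mod (unity_poly r)"
  then obtain g h where "f = g + unity_poly r * h" "g \<in> int_polys" by (elim integral_modE)
  then show "mu_class r f \<in> mu_class r ` int_polys"
    by (intro image_eqI[of _ _ g]) (auto simp: mu_class_eq_iff)
qed

text \<open>The product of common denominators of lifts of the generators bounds the whole group
  they generate.\<close>

lemma finitely_generated_bounded_denominators:
  assumes "finite S" "S \<subseteq> carrier (mu_rat_algebra r)"
    and A: "generate (add_monoid (mu_rat_algebra r)) S = A"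
  shows "\<exists>n>0. \<forall>f. mu_class r f \<in> A \<longrightarrow> of_nat n * f \<in> integral_mod (unity_poly r)"
proof -
  interpret K: mu_subring UNIV "mu_rat_algebra r" r by (rule mu_subring_rat_algebra)
  interpret M: comm_subring "integral_mod (unity_poly r)" by (rule comm_subring_integral_mod)
  \<comment> \<open>Being bounded depends only on the class, since every rational multiple of z^r -
    1 lies in \<open>integral_mod (unity_poly r)\<close>.\<close>
  have transfer: "of_nat n * g \<in> integral_mod (unity_poly r)"
    if f: "of_nat n * f \<in> integral_mod (unity_poly r)" and fg: "mu_class r f = mu_class r g" for n f g
  proof -
    obtain h where h: "f - g = unity_poly r * h" using fg by (metis dvdE mu_class_eq_iff)
    have "of_nat n * g = of_nat n * f - unity_poly r * (of_nat n * h)"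
      using arg_cong[OF h, of "\<lambda>x. of_nat n * x"] by (simp add: algebra_simps)
    then show ?thesis using M.diff_mem[OF f multiple_in_integral_mod] by simp
  qed
  have "\<exists>n>0. \<forall>f. mu_class r f \<in> S \<longrightarrow> of_nat n * f \<in> integral_mod (unity_poly r)"
    using assms(1,2)
  proof (induction S rule: finite_induct)
    case empty
    show ?case by (intro exI[of _ 1]) auto
  next
    case (insert x S)
    then obtain n where n: "n > 0" "\<And>f. mu_class r f \<in> S \<Longrightarrow> of_nat n * f \<in> integral_mod (unity_poly r)"
      by blast
    obtain g where g: "x = mu_class r g" using insert.prems by (auto simp: K.carrier_eq)
    obtain m where m: "m > 0" "of_nat m * g \<in> int_polys" using rat_poly_common_denominator by blast
    have m': "of_nat m * g \<in> integral_mod (unity_poly r)" using m(2) int_polys_subset_integral_mod by blast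
    have "of_nat (n * m) * f \<in> integral_mod (unity_poly r)" if "mu_class r f \<in> insert x S" for f
    proof (cases "mu_class r f = x")
      case True
      then have "of_nat m * f \<in> integral_mod (unity_poly r)" using transfer[OF m'] g by simp
      then have "of_nat n * (of_nat m * f) \<in> integral_mod (unity_poly r)"
        by (rule M.mult_mem[OF M.of_nat_mem])
      then show ?thesis by (simp add: mult.assoc)
    next
      case False
      then have "of_nat m * (of_nat n * f) \<in> integral_mod (unity_poly r)"
        using that by (intro M.mult_mem[OF M.of_nat_mem] n(2)) auto
      then show ?thesis by (simp add: mult_ac)
    qed
    then show ?case using n(1) m(1) by (intro exI[of _ "n * m"]) auto
  qed
  then obtain n where n: "n > 0" "\<And>f. mu_class r f \<in> S \<Longrightarrow> of_nat n * f \<in> integral_mod (unity_poly r)"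
    by blast
  \<comment> \<open>Induction over the generated group provides one bounded lift of each element;
    \<open>transfer\<close> then covers all lifts.\<close>
  have "\<exists>f. x = mu_class r f \<and> of_nat n * f \<in> integral_mod (unity_poly r)" if "x \<in> A" for x
    using that unfolding A[symmetric]
  proof induction
    case one
    show ?case by (intro exI[of _ 0]) (simp add: K.ops M.zero_mem)
  next
    case (incl x)
    then obtain f where f: "x = mu_class r f" using assms(2) by (auto simp: K.carrier_eq)
    then show ?case using n(2) incl by blast
  next
    case (inv x)
    then obtain f where f: "x = mu_class r f" using assms(2) by (auto simp: K.carrier_eq)
    then have "of_nat n * f \<in> integral_mod (unity_poly r)" using n(2) inv by blast
    then have "of_nat n * (- f) \<in> integral_mod (unity_poly r)" using M.uminus_mem by fastforce
    moreover have "inv\<^bsub>add_monoid (mu_rat_algebra r)\<^esub> x = mu_class r (- f)"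
      using K.a_inv_class[of f] by (simp add: f a_inv_def)
    ultimately show ?case by blast
  next
    case (eng x y)
    then obtain f g where "x = mu_class r f" "of_nat n * f \<in> integral_mod (unity_poly r)"
      "y = mu_class r g" "of_nat n * g \<in> integral_mod (unity_poly r)" by blast
    then show ?case
      using M.add_mem[of "of_nat n * f" "of_nat n * g"]
      by (intro exI[of _ "f + g"]) (simp add: K.ops distrib_left)
  qed
  then have "of_nat n * f \<in> integral_mod (unity_poly r)" if "mu_class r f \<in> A" for f
    using that transfer by metis
  then show ?thesis using n(1) by blast
qed

text \<open>The preimage \<open>B\<close> of \<open>A\<close> in Q[z] inherits the subring property
  and the congruences, and finite generation bounds its denominators, so the polynomial theorem
  applies to \<open>B\<close>.\<close>

lemma integral_lambda_model_subset:
  assumes r: "r > 0" and model: "integral_lambda_model A (mu_rat_algebra r) (mu_psi r)"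
  shows "A \<subseteq> mu_class r ` int_polys"
proof -
  let ?K = "mu_rat_algebra r"
  interpret K: mu_subring UNIV ?K r by (rule mu_subring_rat_algebra)
  have sub: "subring A ?K" and stable: "\<And>p. Factorial_Ring.prime p \<Longrightarrow> mu_psi r p ` A \<subseteq> A"
    and lam: "lambda_ring (?K\<lparr>carrier := A\<rparr>) (mu_psi r)"
    using model by (auto simp: integral_lambda_model_def sub_lambda_ring_def)
  obtain S where S: "finite S" "S \<subseteq> A" "generate (add_monoid ?K) S = A"
    using model by (auto simp: integral_lambda_model_def)
  note subE = subringE[OF sub]
  define B where "B = {f. mu_class r f \<in> A}"
  have A_eq: "A = mu_class r ` B"
    using subE(1) by (auto simp: B_def K.carrier_eq)
  have comm: "comm_subring B"
  proof
    show "1 \<in> B" using subE(3) by (simp add: B_def K.ops)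
    fix f g assume "f \<in> B" "g \<in> B"
    then have fg: "mu_class r f \<in> A" "mu_class r g \<in> A" by (auto simp: B_def)
    have "mu_class r (f + - g) \<in> A" using subE(7)[OF fg(1) subE(5)[OF fg(2)]] by (simp add: K.a_inv_class K.ops)
    then show "f - g \<in> B" by (simp add: B_def)
    show "f * g \<in> B" using subE(6)[OF fg] by (simp add: B_def K.ops)
  qed
  have ideal: "unity_poly r * h \<in> B" for h
  proof -
    have "mu_class r (unity_poly r * h) = mu_class r 0" by (simp add: mu_class_eq_iff)
    then show ?thesis using subE(2) by (simp add: B_def K.ops)
  qed
  have frob: "frobenius_stable p B" if p: "Factorial_Ring.prime p" for p
    unfolding frobenius_stable_def
  proof
    fix f assume f: "f \<in> B"
    interpret B: mu_subring B "?K\<lparr>carrier := A\<rparr>" r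
      using mu_subring_carrier_update[OF comm, of r] unfolding A_eq[symmetric] .
    have fp: "substX p f \<in> B" using stable[OF p] f by (auto simp: B_def simp flip: mu_psi_class)
    obtain y where y: "y \<in> A" "mu_psi r p (mu_class r f) \<ominus>\<^bsub>?K\<lparr>carrier := A\<rparr>\<^esub>
        mu_class r f [^]\<^bsub>?K\<lparr>carrier := A\<rparr>\<^esub> p = [p] \<cdot>\<^bsub>?K\<lparr>carrier := A\<rparr>\<^esub> y"
      using lambda_ring.psi_frobenius[OF lam p, of "mu_class r f"] f by (auto simp: B_def)
    obtain g where g: "y = mu_class r g" "g \<in> B" using y(1) A_eq by blast
    have "mu_class r (substX p f - f ^ p) = mu_class r (of_nat p * g)"
      using y(2) by (simp only: g(1) mu_psi_class B.pow_class B.add_pow_class B.a_minus_class[OF fp B.power_mem[OF f]])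
    then obtain h where h: "substX p f - f ^ p - of_nat p * g = unity_poly r * h"
      by (metis dvdE mu_class_eq_iff)
    \<comment> \<open>The congruence in the quotient holds in Q[z] only up to a multiple of z^r - 1.
      Dividing that multiple by \<open>p\<close> stays in \<open>B\<close>, so it is absorbed into
      the Frobenius quotient.\<close>
    define h' where "h' = smult (1 / of_nat p) h"
    have h': "h = of_nat p * h'" using prime_gt_0_nat[OF p] by (simp add: h'_def of_nat_poly)
    have "substX p f - f ^ p = of_nat p * g + unity_poly r * h" using h by (simp add: algebra_simps)
    also have "\<dots> = of_nat p * (g + unity_poly r * h')" unfolding h' by (simp only: distrib_left mult_ac)
    finally show "\<exists>y\<in>B. substX p f - f ^ p = of_nat p * y"
      using B.add_mem[OF g(2) ideal] by blast
  qed
  have "S \<subseteq> carrier ?K" using S(2) subE(1) by blast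
  then obtain N where N: "N > 0" "\<And>f. f \<in> B \<Longrightarrow> of_nat N * f \<in> integral_mod (unity_poly r)"
    using finitely_generated_bounded_denominators[OF S(1) _ S(3)] by (auto simp: B_def)
  have "B \<subseteq> integral_mod (unity_poly r)"
    by (rule frobenius_stable_subset_integral_mod[OF r comm ideal frob N])
  then show ?thesis unfolding A_eq by (auto simp: mu_class_in_int_iff)
qed

theorem theorem0p2:
  fixes r :: nat
  assumes "r \<ge> 1"
  shows "lambda_ring (mu_ring r :: int poly set ring) (mu_psi r)
    \<and> lambda_embedding (mu_ring r :: int poly set ring) (mu_psi r)
        (mu_rat_algebra r) (mu_psi r) (mu_incl r)
    \<and> integral_lambda_model (mu_incl r ` carrier (mu_ring r)) (mu_rat_algebra r) (mu_psi r)
    \<and> (\<forall>A. integral_lambda_model A (mu_rat_algebra r) (mu_psi r)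
          \<longrightarrow> A \<subseteq> mu_incl r ` carrier (mu_ring r))"
proof -
  have "r > 0" using assms by simp
  then show ?thesis
    unfolding mu_incl_image
    using lambda_ring_mu_int lambda_embedding_mu_incl integral_lambda_model_int
      integral_lambda_model_subset by blast
qed

end
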